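(* Let $F$ and $G$ be finite groups and let $(F,G,\triangleleft,\triangleright,\sigma,\tau)$ be such that $(F,G,\triangleleft,\triangleright)$ is a matched pair of groups and $(\sigma,\tau)$ is a pair of compatible normal cocycles. Let $\alpha:F\times G\to\mathbb C$ be an arbitrary map. (1) The formula (extended conjugate linearly) $$(e_g\#f)^*=\alpha(f^{-1},g\triangleleft f)\,e_{g\triangleleft f}\#f^{-1},\qquad g\in G,\ f\in F,$$ defines a structure of $*$-Hopf algebra on $\mathbb C^G\#_{\sigma,\tau}\mathbb CF$ if and only if, for all $g,g_1,g_2\in G$ and $f,f_1,f_2\in F$, $$\alpha(1,g)=\alpha(f,1)=1,$$ $$\alpha(f,g)\,\overline{\alpha(f^{-1},g\triangleleft f)}=1,$$ $$\alpha(f_1,g)\,\alpha(f_2,g\triangleleft f_1)\,\sigma(g;f_1,f_2)=\alpha(f_1f_2,g)\,\overline{\sigma\big(g\triangleleft(f_1f_2);f_2^{-1},f_1^{-1}\big)},$$ $$\alpha(f,g_1g_2)\,\tau(g_1,g_2;f)=\alpha(g_2\triangleright f,g_1)\,\alpha(f,g_2)\,\overline{\tau\big(g_1\triangleleft(g_2\triangleright f),g_2\triangleleft f;f^{-1}\big)}.$$ (2) The pair $(\mathbb C^G\#_{\sigma,\tau}\mathbb CF,* )$ is a compact quantum group if and only if the four conditions in (1) hold and $$\alpha(f^{-1},g\triangleleft f)\,\sigma(g;f,f^{-1})>0\qquad\text{for all }g\in G,\ f\in F.$$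
   Context: A $*$-Hopf algebra is a complex Hopf algebra with a conjugate linear involution $*$ that is antimultiplicative and comultiplicative ($\Delta(x^* )=\sum x_1^*\otimes x_2^*$). A compact quantum group (CQG) is a $*$-Hopf algebra (antipode $\mathcal S$) such that every right comodule $V$ admits an inner product (linear in the first variable) with $\sum\langle u_0,v\rangle\mathcal S(u_1)=\sum\langle u,v_0\rangle v_1^*$ for all $u,v\in V$. For a complex number $z$, "$z>0$" means $z$ is real and positive. A matched pair of groups is a quadruple $(F,G,\triangleleft,\triangleright)$ where $F,G$ are groups, $\triangleleft:G\times F\to G$ is a right action of $F$ on the set $G$, $\triangleright:G\times F\to F$ is a left action of $G$ on the set $F$, and $g\triangleright ff'=(g\triangleright f)\big((g\triangleleft f)\triangleright f'\big)$, $gg'\triangleleft f=\big(g\triangleleft(g'\triangleright f)\big)(g'\triangleleft f)$ for all $f,f'\in F$, $g,g'\in G$. A pair of compatible normal cocycles is a pair of maps $\sigma:G\times F\times F\to\mathbb C^\times$, $(g,f,f')\mapsto\sigma(g;f,f')$, and $\tau:G\times G\times F\to\mathbb C^\times$, $(g,g',f)\mapsto\tau(g,g';f)$, such that for all $g,g',g''\in G$, $f,f',f''\in F$: $\sigma(g\triangleleft f;f',f'')\,\sigma(g;f,f'f'')=\sigma(g;f,f')\,\sigma(g;ff',f'')$; $\sigma(1;f,f')=\sigma(g;1,f')=\sigma(g;f,1)=1$; $\tau(gg',g'';f)\,\tau(g,g';g''\triangleright f)=\tau(g',g'';f)\,\tau(g,g'g'';f)$; $\tau(1,g';f)=\tau(g,1;f)=\tau(g,g';1)=1$;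 $\sigma(gg';f,f')\,\tau(g,g';ff')=\sigma(g;g'\triangleright f,(g'\triangleleft f)\triangleright f')\,\sigma(g';f,f')\,\tau(g,g';f)\,\tau(g\triangleleft(g'\triangleright f),g'\triangleleft f;f')$. $\mathbb C^G\#_{\sigma,\tau}\mathbb CF$ is the vector space with basis $e_g\#f$ ($g\in G$, $f\in F$), with product $(e_g\#f)(e_{g'}\#f')=\delta_{g\triangleleft f,g'}\,\sigma(g;f,f')\,e_g\#ff'$, coproduct $\Delta(e_g\#f)=\sum_{g'g''=g}\tau(g',g'';f)\,e_{g'}\#(g''\triangleright f)\otimes e_{g''}\#f$, unit $\sum_g e_g\#1$ and counit $\varepsilon(e_g\#f)=\delta_{g,1}$; it is a Hopf algebra. *)

theory Defs
  imports
    "HOL-Algebra.Group"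
    "HOL-Library.Function_Algebras"
    "HOL-Library.Complex_Order"
    "HOL-Library.Infinite_Typeclass"
begin

section \<open>Complex vector spaces of functions\<close>

text \<open>
  Vector spaces are subspaces of \<open>'i \<Rightarrow> complex\<close> with pointwise operations.  Up to isomorphism every
  complex vector space whose dimension is at most the cardinality of \<open>'i\<close> is of this form.  For a
  finite set \<open>B\<close>, \<open>vecs B\<close> is the space with basis \<open>B\<close>, the basis vector belonging to
  \<open>b\<close> being \<open>bvec b\<close>; the tensor product of \<open>vecs B\<close> and \<open>vecs C\<close> is \<open>vecs (B \<times> C)\<close>.
\<close>

type_synonym 'i vec = "'i \<Rightarrow> complex"

definition cscale :: "complex \<Rightarrow> 'i vec \<Rightarrow> 'i vec" (infixr "*\<^sub>C" 75)
  where "c *\<^sub>C x = (\<lambda>i. c * x i)"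

global_interpretation cfun: vector_space "cscale :: complex \<Rightarrow> 'i vec \<Rightarrow> 'i vec"
  by standard (auto simp: cscale_def plus_fun_def algebra_simps)

definition vecs :: "'b set \<Rightarrow> 'b vec set"
  where "vecs B = {x. \<forall>b. b \<notin> B \<longrightarrow> x b = 0}"

definition bvec :: "'b \<Rightarrow> 'b vec"
  where "bvec b = (\<lambda>c. if c = b then 1 else 0)"

definition tensor :: "'a vec \<Rightarrow> 'b vec \<Rightarrow> ('a \<times> 'b) vec" (infixr "\<boxtimes>" 75)
  where "x \<boxtimes> y = (\<lambda>(a, b). x a * y b)"

definition linear_on :: "'i vec set \<Rightarrow> (complex \<Rightarrow> 'w \<Rightarrow> 'w) \<Rightarrow> ('i vec \<Rightarrow> 'w::plus) \<Rightarrow> bool"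
  where "linear_on V s T \<longleftrightarrow>
    (\<forall>x\<in>V. \<forall>y\<in>V. T (x + y) = T x + T y) \<and> (\<forall>c. \<forall>x\<in>V. T (c *\<^sub>C x) = s c (T x))"

definition conj_linear_on :: "'i vec set \<Rightarrow> (complex \<Rightarrow> 'w \<Rightarrow> 'w) \<Rightarrow> ('i vec \<Rightarrow> 'w::plus) \<Rightarrow> bool"
  where "conj_linear_on V s T \<longleftrightarrow> linear_on V (\<lambda>c. s (cnj c)) T"

text \<open>The (conjugate) linear map on \<open>vecs B\<close> with the values \<open>\<phi> b\<close> on the basis vectors.\<close>

definition lin_ext :: "'b set \<Rightarrow> ('b \<Rightarrow> 'c vec) \<Rightarrow> 'b vec \<Rightarrow> 'c vec"
  where "lin_ext B \<phi> x = (\<Sum>b\<in>B. x b *\<^sub>C \<phi> b)"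

definition conj_lin_ext :: "'b set \<Rightarrow> ('b \<Rightarrow> 'c vec) \<Rightarrow> 'b vec \<Rightarrow> 'c vec"
  where "conj_lin_ext B \<phi> x = (\<Sum>b\<in>B. cnj (x b) *\<^sub>C \<phi> b)"


section \<open>Finite-dimensional Hopf algebras\<close>

text \<open>The underlying vector space of \<open>H\<close> is \<open>vecs (hbasis H)\<close>.\<close>

record 'b hopf_data =
  hbasis :: "'b set"
  hmult :: "'b vec \<Rightarrow> 'b vec \<Rightarrow> 'b vec" (infixl "\<bullet>\<index>" 70)
  hunit :: "'b vec"
  comult :: "'b vec \<Rightarrow> ('b \<times> 'b) vec"
  counit :: "'b vec \<Rightarrow> complex"

abbreviation hcarrier :: "('b, 'm) hopf_data_scheme \<Rightarrow> 'b vec set"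
  where "hcarrier H \<equiv> vecs (hbasis H)"

definition algebra_axioms :: "('b, 'm) hopf_data_scheme \<Rightarrow> bool"
  where "algebra_axioms H \<longleftrightarrow>
    hunit H \<in> hcarrier H \<and>
    (\<forall>x\<in>hcarrier H. \<forall>y\<in>hcarrier H. x \<bullet>\<^bsub>H\<^esub> y \<in> hcarrier H) \<and>
    (\<forall>x\<in>hcarrier H. linear_on (hcarrier H) cscale (\<lambda>y. x \<bullet>\<^bsub>H\<^esub> y)) \<and>
    (\<forall>y\<in>hcarrier H. linear_on (hcarrier H) cscale (\<lambda>x. x \<bullet>\<^bsub>H\<^esub> y)) \<and>
    (\<forall>x\<in>hcarrier H. \<forall>y\<in>hcarrier H. \<forall>z\<in>hcarrier H.
      (x \<bullet>\<^bsub>H\<^esub> y) \<bullet>\<^bsub>H\<^esub> z = x \<bullet>\<^bsub>H\<^esub> (y \<bullet>\<^bsub>H\<^esub> z)) \<and>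
    (\<forall>x\<in>hcarrier H. hunit H \<bullet>\<^bsub>H\<^esub> x = x \<and> x \<bullet>\<^bsub>H\<^esub> hunit H = x)"

text \<open>
  In the coassociativity axiom both sides are compared coordinatewise, since the two bracketings of
  the threefold tensor product are different types.
\<close>

definition coalgebra_axioms :: "('b, 'm) hopf_data_scheme \<Rightarrow> bool"
  where "coalgebra_axioms H \<longleftrightarrow>
    (\<forall>x\<in>hcarrier H. comult H x \<in> vecs (hbasis H \<times> hbasis H)) \<and>
    linear_on (hcarrier H) cscale (comult H) \<and>
    linear_on (hcarrier H) (*) (counit H) \<and>
    (\<forall>x\<in>hcarrier H. \<forall>a b c.
      lin_ext (hbasis H \<times> hbasis H) (\<lambda>(u, v). comult H (bvec u) \<boxtimes> bvec v) (comult H x) ((a, b), c) =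
      lin_ext (hbasis H \<times> hbasis H) (\<lambda>(u, v). bvec u \<boxtimes> comult H (bvec v)) (comult H x) (a, (b, c))) \<and>
    (\<forall>x\<in>hcarrier H.
      lin_ext (hbasis H \<times> hbasis H) (\<lambda>(u, v). counit H (bvec u) *\<^sub>C bvec v) (comult H x) = x \<and>
      lin_ext (hbasis H \<times> hbasis H) (\<lambda>(u, v). counit H (bvec v) *\<^sub>C bvec u) (comult H x) = x)"

definition tensor_mult :: "('b, 'm) hopf_data_scheme \<Rightarrow> ('b \<times> 'b) vec \<Rightarrow> ('b \<times> 'b) vec \<Rightarrow> ('b \<times> 'b) vec"
  where "tensor_mult H w z =
    lin_ext ((hbasis H \<times> hbasis H) \<times> (hbasis H \<times> hbasis H))
      (\<lambda>((a, b), (c, d)). (bvec a \<bullet>\<^bsub>H\<^esub> bvec c) \<boxtimes> (bvec b \<bullet>\<^bsub>H\<^esub> bvec d)) (w \<boxtimes> z)"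

definition bialgebra :: "('b, 'm) hopf_data_scheme \<Rightarrow> bool"
  where "bialgebra H \<longleftrightarrow>
    finite (hbasis H) \<and> algebra_axioms H \<and> coalgebra_axioms H \<and>
    (\<forall>x\<in>hcarrier H. \<forall>y\<in>hcarrier H.
      comult H (x \<bullet>\<^bsub>H\<^esub> y) = tensor_mult H (comult H x) (comult H y) \<and>
      counit H (x \<bullet>\<^bsub>H\<^esub> y) = counit H x * counit H y) \<and>
    comult H (hunit H) = hunit H \<boxtimes> hunit H \<and>
    counit H (hunit H) = 1"

definition is_antipode :: "('b, 'm) hopf_data_scheme \<Rightarrow> ('b vec \<Rightarrow> 'b vec) \<Rightarrow> bool"
  where "is_antipode H S \<longleftrightarrow>
    (\<forall>x\<in>hcarrier H. S x \<in> hcarrier H) \<and>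
    linear_on (hcarrier H) cscale S \<and>
    (\<forall>x\<in>hcarrier H.
      lin_ext (hbasis H \<times> hbasis H) (\<lambda>(u, v). S (bvec u) \<bullet>\<^bsub>H\<^esub> bvec v) (comult H x)
        = counit H x *\<^sub>C hunit H \<and>
      lin_ext (hbasis H \<times> hbasis H) (\<lambda>(u, v). bvec u \<bullet>\<^bsub>H\<^esub> S (bvec v)) (comult H x)
        = counit H x *\<^sub>C hunit H)"

definition hopf_algebra :: "('b, 'm) hopf_data_scheme \<Rightarrow> bool"
  where "hopf_algebra H \<longleftrightarrow> bialgebra H \<and> (\<exists>S. is_antipode H S)"

text \<open>
  The antipode is unique on \<open>hcarrier H\<close>; its values elsewhere are irrelevant, which is why this
  is not a definite description.
\<close>

definition antipode :: "('b, 'm) hopf_data_scheme \<Rightarrow> 'b vec \<Rightarrow> 'b vec"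
  where "antipode H = (SOME S. is_antipode H S)"

definition star_hopf_algebra :: "('b, 'm) hopf_data_scheme \<Rightarrow> ('b vec \<Rightarrow> 'b vec) \<Rightarrow> bool"
  where "star_hopf_algebra H star \<longleftrightarrow>
    hopf_algebra H \<and>
    (\<forall>x\<in>hcarrier H. star x \<in> hcarrier H) \<and>
    conj_linear_on (hcarrier H) cscale star \<and>
    (\<forall>x\<in>hcarrier H. star (star x) = x) \<and>
    (\<forall>x\<in>hcarrier H. \<forall>y\<in>hcarrier H. star (x \<bullet>\<^bsub>H\<^esub> y) = star y \<bullet>\<^bsub>H\<^esub> star x) \<and>
    (\<forall>x\<in>hcarrier H. comult H (star x) =
      conj_lin_ext (hbasis H \<times> hbasis H) (\<lambda>(u, v). star (bvec u) \<boxtimes> star (bvec v)) (comult H x))"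


section \<open>Comodules and compact quantum groups\<close>

text \<open>
  An element of the tensor product of \<open>V\<close> with \<open>hcarrier H\<close> is written uniquely as the sum of
  \<open>v b\<close> tensor \<open>bvec b\<close> over \<open>b \<in> hbasis H\<close>, with \<open>v b \<in> V\<close>.  Accordingly the
  coaction sends \<open>v\<close> to the family \<open>\<rho> v\<close>.  Comparing the coefficients at \<open>bvec b \<boxtimes> bvec c\<close>
  turns coassociativity of the coaction into the equation below.
\<close>

definition right_comodule ::
    "('b, 'm) hopf_data_scheme \<Rightarrow> 'i vec set \<Rightarrow> ('i vec \<Rightarrow> 'b \<Rightarrow> 'i vec) \<Rightarrow> bool"
  where "right_comodule H V \<rho> \<longleftrightarrow>
    cfun.subspace V \<and>
    (\<forall>b\<in>hbasis H. (\<forall>v\<in>V. \<rho> v b \<in> V) \<and> linear_on V cscale (\<lambda>v. \<rho> v b)) \<and>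
    (\<forall>v\<in>V. \<forall>b\<in>hbasis H. \<forall>c\<in>hbasis H.
      \<rho> (\<rho> v c) b = (\<Sum>d\<in>hbasis H. comult H (bvec d) (b, c) *\<^sub>C \<rho> v d)) \<and>
    (\<forall>v\<in>V. (\<Sum>d\<in>hbasis H. counit H (bvec d) *\<^sub>C \<rho> v d) = v)"

text \<open>On \<^typ>\<open>complex\<close>, \<open>z > 0\<close> says that \<open>z\<close> is real and positive.\<close>

definition inner_product_on :: "'i vec set \<Rightarrow> ('i vec \<Rightarrow> 'i vec \<Rightarrow> complex) \<Rightarrow> bool"
  where "inner_product_on V ip \<longleftrightarrow>
    (\<forall>v\<in>V. linear_on V (*) (\<lambda>u. ip u v)) \<and>
    (\<forall>u\<in>V. \<forall>v\<in>V. ip v u = cnj (ip u v)) \<and>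
    (\<forall>v\<in>V. v \<noteq> 0 \<longrightarrow> ip v v > 0)"

text \<open>
  A formula cannot quantify over types, so comodules are taken among the subspaces of
  \<open>'i \<Rightarrow> complex\<close>, and the index type \<open>'i\<close> is a parameter of the definition.  Being of class
  \<^class>\<open>infinite\<close> it accommodates all finite-dimensional comodules.  Comodules of larger
  dimension are covered by choosing \<open>'i\<close> large enough.
\<close>

definition compact_quantum_group ::
    "'i::infinite itself \<Rightarrow> ('b, 'm) hopf_data_scheme \<Rightarrow> ('b vec \<Rightarrow> 'b vec) \<Rightarrow> bool"
  where "compact_quantum_group TYPE('i) H star \<longleftrightarrow>
    star_hopf_algebra H star \<and>
    (\<forall>(V :: 'i vec set) \<rho>. right_comodule H V \<rho> \<longrightarrow>
      (\<exists>ip. inner_product_on V ip \<and>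
        (\<forall>u\<in>V. \<forall>v\<in>V.
          (\<Sum>b\<in>hbasis H. ip (\<rho> u b) v *\<^sub>C antipode H (bvec b)) =
          (\<Sum>b\<in>hbasis H. ip u (\<rho> v b) *\<^sub>C star (bvec b)))))"


section \<open>Matched pairs of groups and compatible cocycles\<close>

locale matched_pair = F: group F + G: group G for F (structure) and G (structure) +
  fixes la :: "'g \<Rightarrow> 'f \<Rightarrow> 'g" (infixl "\<triangleleft>" 75)
    and ra :: "'g \<Rightarrow> 'f \<Rightarrow> 'f" (infixr "\<triangleright>" 75)
  assumes la_closed: "\<lbrakk>g \<in> carrier G; f \<in> carrier F\<rbrakk> \<Longrightarrow> g \<triangleleft> f \<in> carrier G"
    and ra_closed: "\<lbrakk>g \<in> carrier G; f \<in> carrier F\<rbrakk> \<Longrightarrow> g \<triangleright> f \<in> carrier F"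
    and la_one: "g \<in> carrier G \<Longrightarrow> g \<triangleleft> \<one>\<^bsub>F\<^esub> = g"
    and la_mult: "\<lbrakk>g \<in> carrier G; f \<in> carrier F; f' \<in> carrier F\<rbrakk> \<Longrightarrow>
      g \<triangleleft> (f \<otimes>\<^bsub>F\<^esub> f') = (g \<triangleleft> f) \<triangleleft> f'"
    and ra_one: "f \<in> carrier F \<Longrightarrow> \<one>\<^bsub>G\<^esub> \<triangleright> f = f"
    and ra_mult: "\<lbrakk>g \<in> carrier G; g' \<in> carrier G; f \<in> carrier F\<rbrakk> \<Longrightarrow>
      (g \<otimes>\<^bsub>G\<^esub> g') \<triangleright> f = g \<triangleright> (g' \<triangleright> f)"
    and ra_distrib: "\<lbrakk>g \<in> carrier G; f \<in> carrier F; f' \<in> carrier F\<rbrakk> \<Longrightarrow>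
      g \<triangleright> (f \<otimes>\<^bsub>F\<^esub> f') = (g \<triangleright> f) \<otimes>\<^bsub>F\<^esub> ((g \<triangleleft> f) \<triangleright> f')"
    and la_distrib: "\<lbrakk>g \<in> carrier G; g' \<in> carrier G; f \<in> carrier F\<rbrakk> \<Longrightarrow>
      (g \<otimes>\<^bsub>G\<^esub> g') \<triangleleft> f = (g \<triangleleft> (g' \<triangleright> f)) \<otimes>\<^bsub>G\<^esub> (g' \<triangleleft> f)"

locale compatible_normal_cocycles = matched_pair F G la ra
  for F (structure) and G (structure)
    and la :: "'g \<Rightarrow> 'f \<Rightarrow> 'g" (infixl "\<triangleleft>" 75)
    and ra :: "'g \<Rightarrow> 'f \<Rightarrow> 'f" (infixr "\<triangleright>" 75) +
  fixes \<sigma> :: "'g \<Rightarrow> 'f \<Rightarrow> 'f \<Rightarrow> complex"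
    and \<tau> :: "'g \<Rightarrow> 'g \<Rightarrow> 'f \<Rightarrow> complex"
  assumes sigma_nonzero: "\<lbrakk>g \<in> carrier G; f \<in> carrier F; f' \<in> carrier F\<rbrakk> \<Longrightarrow> \<sigma> g f f' \<noteq> 0"
    and tau_nonzero: "\<lbrakk>g \<in> carrier G; g' \<in> carrier G; f \<in> carrier F\<rbrakk> \<Longrightarrow> \<tau> g g' f \<noteq> 0"
    and sigma_cocycle:
      "\<lbrakk>g \<in> carrier G; f \<in> carrier F; f' \<in> carrier F; f'' \<in> carrier F\<rbrakk> \<Longrightarrow>
        \<sigma> (g \<triangleleft> f) f' f'' * \<sigma> g f (f' \<otimes>\<^bsub>F\<^esub> f'') = \<sigma> g f f' * \<sigma> g (f \<otimes>\<^bsub>F\<^esub> f') f''"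
    and sigma_normal:
      "\<lbrakk>f \<in> carrier F; f' \<in> carrier F\<rbrakk> \<Longrightarrow> \<sigma> \<one>\<^bsub>G\<^esub> f f' = 1"
      "\<lbrakk>g \<in> carrier G; f' \<in> carrier F\<rbrakk> \<Longrightarrow> \<sigma> g \<one>\<^bsub>F\<^esub> f' = 1"
      "\<lbrakk>g \<in> carrier G; f \<in> carrier F\<rbrakk> \<Longrightarrow> \<sigma> g f \<one>\<^bsub>F\<^esub> = 1"
    and tau_cocycle:
      "\<lbrakk>g \<in> carrier G; g' \<in> carrier G; g'' \<in> carrier G; f \<in> carrier F\<rbrakk> \<Longrightarrow>
        \<tau> (g \<otimes>\<^bsub>G\<^esub> g') g'' f * \<tau> g g' (g'' \<triangleright> f) = \<tau> g' g'' f * \<tau> g (g' \<otimes>\<^bsub>G\<^esub> g'') f"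
    and tau_normal:
      "\<lbrakk>g' \<in> carrier G; f \<in> carrier F\<rbrakk> \<Longrightarrow> \<tau> \<one>\<^bsub>G\<^esub> g' f = 1"
      "\<lbrakk>g \<in> carrier G; f \<in> carrier F\<rbrakk> \<Longrightarrow> \<tau> g \<one>\<^bsub>G\<^esub> f = 1"
      "\<lbrakk>g \<in> carrier G; g' \<in> carrier G\<rbrakk> \<Longrightarrow> \<tau> g g' \<one>\<^bsub>F\<^esub> = 1"
    and sigma_tau_compatible:
      "\<lbrakk>g \<in> carrier G; g' \<in> carrier G; f \<in> carrier F; f' \<in> carrier F\<rbrakk> \<Longrightarrow>
        \<sigma> (g \<otimes>\<^bsub>G\<^esub> g') f f' * \<tau> g g' (f \<otimes>\<^bsub>F\<^esub> f') =
        \<sigma> g (g' \<triangleright> f) ((g' \<triangleleft> f) \<triangleright> f') * \<sigma> g' f f' *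
        \<tau> g g' f * \<tau> (g \<triangleleft> (g' \<triangleright> f)) (g' \<triangleleft> f) f'"


section \<open>The bicrossed product\<close>

text \<open>The basis element \<open>e\<^sub>g # f\<close> is \<open>bvec (g, f)\<close>.\<close>

definition bicrossed ::
    "('f, 'm) monoid_scheme \<Rightarrow> ('g, 'n) monoid_scheme \<Rightarrow>
     ('g \<Rightarrow> 'f \<Rightarrow> 'g) \<Rightarrow> ('g \<Rightarrow> 'f \<Rightarrow> 'f) \<Rightarrow>
     ('g \<Rightarrow> 'f \<Rightarrow> 'f \<Rightarrow> complex) \<Rightarrow> ('g \<Rightarrow> 'g \<Rightarrow> 'f \<Rightarrow> complex) \<Rightarrow> ('g \<times> 'f) hopf_data"
  where "bicrossed F G la ra \<sigma> \<tau> = \<lparr>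
    hbasis = carrier G \<times> carrier F,
    hmult = (\<lambda>x y.
      lin_ext ((carrier G \<times> carrier F) \<times> (carrier G \<times> carrier F))
        (\<lambda>((g, f), (g', f')).
          if la g f = g' then \<sigma> g f f' *\<^sub>C bvec (g, f \<otimes>\<^bsub>F\<^esub> f') else 0)
        (x \<boxtimes> y)),
    hunit = (\<Sum>g\<in>carrier G. bvec (g, \<one>\<^bsub>F\<^esub>)),
    comult =
      lin_ext (carrier G \<times> carrier F)
        (\<lambda>(g, f). \<Sum>(g', g'')\<in>{(g', g''). g' \<in> carrier G \<and> g'' \<in> carrier G \<and> g' \<otimes>\<^bsub>G\<^esub> g'' = g}.
          \<tau> g' g'' f *\<^sub>C (bvec (g', ra g'' f) \<boxtimes> bvec (g'', f))),
    counit = (\<lambda>x. \<Sum>(g, f)\<in>carrier G \<times> carrier F. x (g, f) * (if g = \<one>\<^bsub>G\<^esub> then 1 else 0))\<rparr>"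

definition bicrossed_star ::
    "('f, 'm) monoid_scheme \<Rightarrow> ('g, 'n) monoid_scheme \<Rightarrow> ('g \<Rightarrow> 'f \<Rightarrow> 'g) \<Rightarrow>
     ('f \<Rightarrow> 'g \<Rightarrow> complex) \<Rightarrow> ('g \<times> 'f) vec \<Rightarrow> ('g \<times> 'f) vec"
  where "bicrossed_star F G la \<alpha> =
    conj_lin_ext (carrier G \<times> carrier F)
      (\<lambda>(g, f). \<alpha> (inv\<^bsub>F\<^esub> f) (la g f) *\<^sub>C bvec (la g f, inv\<^bsub>F\<^esub> f))"

definition star_conditions ::
    "('f, 'm) monoid_scheme \<Rightarrow> ('g, 'n) monoid_scheme \<Rightarrow>
     ('g \<Rightarrow> 'f \<Rightarrow> 'g) \<Rightarrow> ('g \<Rightarrow> 'f \<Rightarrow> 'f) \<Rightarrow>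
     ('g \<Rightarrow> 'f \<Rightarrow> 'f \<Rightarrow> complex) \<Rightarrow> ('g \<Rightarrow> 'g \<Rightarrow> 'f \<Rightarrow> complex) \<Rightarrow> ('f \<Rightarrow> 'g \<Rightarrow> complex) \<Rightarrow> bool"
  where "star_conditions F G la ra \<sigma> \<tau> \<alpha> \<longleftrightarrow>
    (\<forall>g\<in>carrier G. \<alpha> \<one>\<^bsub>F\<^esub> g = 1) \<and>
    (\<forall>f\<in>carrier F. \<alpha> f \<one>\<^bsub>G\<^esub> = 1) \<and>
    (\<forall>g\<in>carrier G. \<forall>f\<in>carrier F. \<alpha> f g * cnj (\<alpha> (inv\<^bsub>F\<^esub> f) (la g f)) = 1) \<and>
    (\<forall>g\<in>carrier G. \<forall>f\<^sub>1\<in>carrier F. \<forall>f\<^sub>2\<in>carrier F.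
      \<alpha> f\<^sub>1 g * \<alpha> f\<^sub>2 (la g f\<^sub>1) * \<sigma> g f\<^sub>1 f\<^sub>2 =
      \<alpha> (f\<^sub>1 \<otimes>\<^bsub>F\<^esub> f\<^sub>2) g * cnj (\<sigma> (la g (f\<^sub>1 \<otimes>\<^bsub>F\<^esub> f\<^sub>2)) (inv\<^bsub>F\<^esub> f\<^sub>2) (inv\<^bsub>F\<^esub> f\<^sub>1))) \<and>
    (\<forall>g\<^sub>1\<in>carrier G. \<forall>g\<^sub>2\<in>carrier G. \<forall>f\<in>carrier F.
      \<alpha> f (g\<^sub>1 \<otimes>\<^bsub>G\<^esub> g\<^sub>2) * \<tau> g\<^sub>1 g\<^sub>2 f =
      \<alpha> (ra g\<^sub>2 f) g\<^sub>1 * \<alpha> f g\<^sub>2 * cnj (\<tau> (la g\<^sub>1 (ra g\<^sub>2 f)) (la g\<^sub>2 f) (inv\<^bsub>F\<^esub> f)))"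

end

theory Submission
  imports Defs
begin

text \<open>
  Write \<open>x (g, f)\<close> for the coefficient of the basis vector \<open>e\<^sub>g # f\<close>.  All structure maps have short
  formulas in these coordinates: a product is a convolution over \<open>F\<close> (\<open>mult_apply\<close>), while every
  coordinate of a coproduct or of \<open>x\<^sup>*\<close> is zero or a multiple of a single coordinate of \<open>x\<close> or of its conjugate
  (\<open>comult_apply\<close>, \<open>star_apply\<close>).  Each Hopf algebra axiom therefore becomes a scalar identity, which
  is the corresponding axiom of a matched pair or of a pair of compatible cocycles; the antipode permutes the
  coordinates up to scalars, and its shape can be read off from the antipode equation.

  The same comparison of coefficients characterises the involution.  Involutivity, antimultiplicativity
  and comultiplicativity are each equivalent to one condition on \<open>\<alpha>\<close>: applied to suitable basis vectors,
  both sides of the axiom reduce to a single term.  The normalisation of \<open>\<alpha>\<close> follows, since these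
  conditions make \<open>\<alpha>(1, g)\<close> and \<open>\<alpha>(f, 1)\<close> nonzero idempotents.

  Compactness is governed by the numbers \<open>w(g, f) = \<alpha>(f\<inverse>, g \<triangleleft> f) \<sigma>(g; f, f\<inverse>)\<close>.  The Haar functional
  is \<open>h(e\<^sub>g # f) = \<delta>\<^sub>f\<^sub>,\<^sub>1\<close> up to a factor, and the form \<open>h(y\<^sup>* x)\<close> is diagonal in the given basis with entries
  \<open>w(g, f)\<close>.  If these are positive, averaging any inner product of a comodule over the Haar functional,
  \<open>\<langle>u, v\<rangle>' = \<Sum> \<langle>u\<^sub>0, v\<^sub>0\<rangle> h(v\<^sub>1\<^sup>* u\<^sub>1)\<close>, gives an inner product with the required invariance; in coordinates the
  invariance comes down to \<open>w\<close> being multiplicative up to \<open>\<bar>\<tau>\<bar>\<^sup>2\<close> (\<open>weight_mult\<close>).  Conversely, an invariant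
  inner product on the regular comodule satisfies
  \<open>\<langle>e\<^sub>k # q, e\<^sub>k # q\<rangle> = w(k, q) \<langle>e\<^sub>1 # (k \<triangleright> q), e\<^sub>1 # (k \<triangleright> q)\<rangle>\<close>, which forces \<open>w(k, q) > 0\<close>.
\<close>

section \<open>Coordinates of vectors\<close>

lemma sum_apply: "(\<Sum>a\<in>A. \<phi> a) i = (\<Sum>a\<in>A. \<phi> a i)" for \<phi> :: "'a \<Rightarrow> 'b vec"
  by (induction A rule: infinite_finite_induct) auto

lemma cscale_apply [simp]: "(c *\<^sub>C x) i = c * x i"
  by (simp add: cscale_def)

lemma lin_ext_apply: "lin_ext B \<phi> x i = (\<Sum>b\<in>B. x b * \<phi> b i)"
  by (simp add: lin_ext_def sum_apply)

lemma conj_lin_ext_apply: "conj_lin_ext B \<phi> x i = (\<Sum>b\<in>B. cnj (x b) * \<phi> b i)"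
  by (simp add: conj_lin_ext_def sum_apply)

lemma lin_ext_add: "lin_ext B \<phi> (x + y) = lin_ext B \<phi> x + lin_ext B \<phi> y"
  by (rule ext) (simp add: lin_ext_apply algebra_simps sum.distrib)

lemma lin_ext_scale: "lin_ext B \<phi> (c *\<^sub>C x) = c *\<^sub>C lin_ext B \<phi> x"
  by (rule ext) (simp add: lin_ext_apply sum_distrib_left mult.assoc)

lemma tensor_apply [simp]: "(x \<boxtimes> y) (a, b) = x a * y b"
  by (simp add: tensor_def)

lemma bvec_apply: "bvec b c = (if c = b then 1 else 0)"
  by (simp add: bvec_def)

lemma bvec_in_vecs: "b \<in> B \<Longrightarrow> bvec b \<in> vecs B"
  by (auto simp: vecs_def bvec_def)

lemma vecs_zero_outside: "x \<in> vecs B \<Longrightarrow> b \<notin> B \<Longrightarrow> x b = 0"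
  by (auto simp: vecs_def)

lemma sum_bvec: "finite B \<Longrightarrow> c \<in> B \<Longrightarrow> (\<Sum>b\<in>B. \<phi> b * bvec b c) = \<phi> c"
  by (simp add: bvec_apply if_distrib cong: if_cong)

lemma sum_if_const: "(\<Sum>a\<in>A. if P then \<phi> a else 0) = (if P then \<Sum>a\<in>A. \<phi> a else 0)"
  by simp

section \<open>Inner products\<close>

text \<open>
  A comodule may have infinite dimension, so the coordinates are taken with respect to a Hamel basis; each
  vector has only finitely many of them.
\<close>

lemma inner_product_exists: "\<exists>ip. inner_product_on (UNIV :: 'i vec set) ip"
proof -
  obtain E :: "'i vec set" where E: "cfun.independent E" "UNIV \<subseteq> cfun.span E"
    by (rule cfun.basis_exists[of UNIV])
  then have E: "cfun.independent E" "cfun.span E = UNIV"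
    by auto
  let ?r = "cfun.representation E"
  define ip where "ip u v = (\<Sum>e | ?r u e \<noteq> 0. ?r u e * cnj (?r v e))" for u v
  have fin: "finite {e. ?r u e \<noteq> 0}" for u
    by (rule cfun.finite_representation)
  have ip_eq: "ip u v = (\<Sum>e\<in>K. ?r u e * cnj (?r v e))" if "finite K" "{e. ?r u e \<noteq> 0} \<subseteq> K" for K u v
    unfolding ip_def using that by (intro sum.mono_neutral_left) auto
  have add: "ip (u + u') v = ip u v + ip u' v" for u u' v
  proof -
    let ?K = "{e. ?r u e \<noteq> 0} \<union> {e. ?r u' e \<noteq> 0} \<union> {e. ?r (u + u') e \<noteq> 0}"
    have K: "ip w v = (\<Sum>e\<in>?K. ?r w e * cnj (?r v e))" if "w \<in> {u, u', u + u'}" for w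
      using that fin by (intro ip_eq) auto
    show ?thesis
      by (simp add: K cfun.representation_add[OF E(1)] E(2) distrib_right sum.distrib)
  qed
  have scale: "ip (c *\<^sub>C u) v = c * ip u v" for c u v
  proof -
    let ?K = "{e. ?r u e \<noteq> 0} \<union> {e. ?r (c *\<^sub>C u) e \<noteq> 0}"
    have K: "ip w v = (\<Sum>e\<in>?K. ?r w e * cnj (?r v e))" if "w \<in> {u, c *\<^sub>C u}" for w
      using that fin by (intro ip_eq) auto
    show ?thesis
      by (simp add: K cfun.representation_scale[OF E(1)] E(2) sum_distrib_left mult.assoc)
  qed
  have herm: "ip v u = cnj (ip u v)" for u v
  proof -
    let ?K = "{e. ?r u e \<noteq> 0} \<union> {e. ?r v e \<noteq> 0}"
    have K: "ip w w' = (\<Sum>e\<in>?K. ?r w e * cnj (?r w' e))" if "w \<in> {u, v}" for w w'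
      using that fin by (intro ip_eq) auto
    show ?thesis by (simp add: K mult.commute)
  qed
  have pos: "ip v v > 0" if "v \<noteq> 0" for v
  proof -
    have "{e. ?r v e \<noteq> 0} \<noteq> {}"
      using cfun.sum_nonzero_representation_eq[OF E(1), of v] E(2) that by auto
    then have "(\<Sum>e | ?r v e \<noteq> 0. (cmod (?r v e))\<^sup>2) > 0"
      using fin[of v] by (intro sum_pos) auto
    moreover have "ip v v = of_real (\<Sum>e | ?r v e \<noteq> 0. (cmod (?r v e))\<^sup>2)"
      unfolding ip_def by (simp add: complex_norm_square del: of_real_power)
    ultimately show ?thesis by (simp add: less_complex_def)
  qed
  have "inner_product_on UNIV ip"
    unfolding inner_product_on_def linear_on_def
    by (intro conjI ballI allI impI add scale pos) (rule herm)
  then show ?thesis by blast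
qed

lemma inner_product_zero:
  assumes "inner_product_on UNIV ip" shows "ip 0 v = 0"
proof -
  have "ip (0 *\<^sub>C 0) v = 0 * ip 0 v"
    using assms unfolding inner_product_on_def linear_on_def by blast
  then show ?thesis by (simp add: cfun.scale_zero_left)
qed

text \<open>
  The form that arises from averaging an inner product over a coaction \<open>\<rho>\<close>.  Definiteness needs the
  family of maps \<open>v \<mapsto> \<rho> v b\<close> to be jointly injective, which for a coaction is a consequence of the counit axiom.
\<close>

lemma inner_product_weighted_sum:
  fixes \<rho> :: "'i vec \<Rightarrow> 'b \<Rightarrow> 'i vec"
  assumes ip: "inner_product_on UNIV ip" and "finite A"
    and lin: "\<And>b. b \<in> A \<Longrightarrow> linear_on V cscale (\<lambda>v. \<rho> v b)"
    and inj: "\<And>v. \<lbrakk>v \<in> V; \<And>b. b \<in> A \<Longrightarrow> \<rho> v b = 0\<rbrakk> \<Longrightarrow> v = 0"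
    and w: "\<And>b. b \<in> A \<Longrightarrow> w b > 0"
  shows "inner_product_on V (\<lambda>u v. \<Sum>b\<in>A. w b * ip (\<rho> u b) (\<rho> v b))"
proof -
  have ip_add: "ip (u + u') v = ip u v + ip u' v" and ip_scale: "ip (c *\<^sub>C u) v = c * ip u v"
    and ip_herm: "ip v u = cnj (ip u v)" for u u' v c
    using ip unfolding inner_product_on_def linear_on_def by blast+
  have ip_pos: "ip v v > 0" if "v \<noteq> 0" for v
    using ip that unfolding inner_product_on_def by blast
  have nonneg: "Im (ip v v) = 0 \<and> Re (ip v v) \<ge> 0" for v
    using ip_pos[of v] inner_product_zero[OF ip, of v] by (cases "v = 0") (auto simp: less_complex_def)
  have real_w: "cnj (w b) = w b" "Im (w b) = 0" "Re (w b) > 0" if "b \<in> A" for b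
    using w[OF that] by (auto simp: less_complex_def complex_eq_iff)
  have "(\<Sum>b\<in>A. w b * ip (\<rho> v b) (\<rho> v b)) > 0" (is "?s > 0") if v: "v \<in> V" "v \<noteq> 0" for v
  proof -
    obtain c where c: "c \<in> A" "\<rho> v c \<noteq> 0" using inj v by blast
    have "(\<Sum>b\<in>A. Re (w b) * Re (ip (\<rho> v b) (\<rho> v b))) > 0"
    proof (rule sum_pos2[OF \<open>finite A\<close> c(1)])
      show "0 < Re (w c) * Re (ip (\<rho> v c) (\<rho> v c))"
        using ip_pos[OF c(2)] real_w[OF c(1)] by (simp add: less_complex_def)
      show "0 \<le> Re (w b) * Re (ip (\<rho> v b) (\<rho> v b))" if "b \<in> A" for b
        using nonneg real_w[OF that] by (simp add: less_imp_le)
    qed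
    moreover have "Re ?s = (\<Sum>b\<in>A. Re (w b) * Re (ip (\<rho> v b) (\<rho> v b)))" "Im ?s = 0"
      using nonneg real_w by simp_all
    ultimately show ?thesis by (simp add: less_complex_def)
  qed
  moreover have "(\<Sum>b\<in>A. w b * ip (\<rho> v b) (\<rho> u b)) = cnj (\<Sum>b\<in>A. w b * ip (\<rho> u b) (\<rho> v b))" for u v
    unfolding cnj_sum complex_cnj_mult using real_w
    by (intro sum.cong refl) (simp add: ip_herm[of "\<rho> v _" "\<rho> u _"])
  moreover have "linear_on V (*) (\<lambda>u. \<Sum>b\<in>A. w b * ip (\<rho> u b) (\<rho> v b))" for v
    using lin by (auto simp: linear_on_def ip_add ip_scale sum_distrib_left distrib_left mult_ac
        simp flip: sum.distrib intro!: sum.cong)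
  ultimately show ?thesis unfolding inner_product_on_def by blast
qed

section \<open>Identities in a matched pair with cocycles\<close>

locale finite_bicrossed = compatible_normal_cocycles F G la ra \<sigma> \<tau>
  for F (structure) and G (structure)
    and la :: "'g \<Rightarrow> 'f \<Rightarrow> 'g" (infixl "\<triangleleft>" 75)
    and ra :: "'g \<Rightarrow> 'f \<Rightarrow> 'f" (infixr "\<triangleright>" 75)
    and \<sigma> :: "'g \<Rightarrow> 'f \<Rightarrow> 'f \<Rightarrow> complex"
    and \<tau> :: "'g \<Rightarrow> 'g \<Rightarrow> 'f \<Rightarrow> complex" +
  assumes finite_F: "finite (carrier F)" and finite_G: "finite (carrier G)"
begin

lemmas closed [simp] = la_closed ra_closed
lemmas units [simp] = la_one ra_one sigma_normal tau_normal

lemma F_cancel [simp]: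
  assumes "a \<in> carrier F" "b \<in> carrier F"
  shows "a \<otimes>\<^bsub>F\<^esub> (inv\<^bsub>F\<^esub> a \<otimes>\<^bsub>F\<^esub> b) = b" "inv\<^bsub>F\<^esub> a \<otimes>\<^bsub>F\<^esub> (a \<otimes>\<^bsub>F\<^esub> b) = b"
  using assms by (simp_all flip: F.m_assoc)

lemma ra_fone [simp]:
  assumes "g \<in> carrier G" shows "g \<triangleright> \<one>\<^bsub>F\<^esub> = \<one>\<^bsub>F\<^esub>"
proof -
  have "g \<triangleright> \<one>\<^bsub>F\<^esub> = (g \<triangleright> \<one>\<^bsub>F\<^esub>) \<otimes>\<^bsub>F\<^esub> (g \<triangleright> \<one>\<^bsub>F\<^esub>)"
    using ra_distrib[of g "\<one>\<^bsub>F\<^esub>" "\<one>\<^bsub>F\<^esub>"] assms by simp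
  then show ?thesis using assms F.r_cancel_one'[of "g \<triangleright> \<one>\<^bsub>F\<^esub>" "g \<triangleright> \<one>\<^bsub>F\<^esub>"] by simp
qed

lemma la_gone [simp]:
  assumes "f \<in> carrier F" shows "\<one>\<^bsub>G\<^esub> \<triangleleft> f = \<one>\<^bsub>G\<^esub>"
proof -
  have "\<one>\<^bsub>G\<^esub> \<triangleleft> f = (\<one>\<^bsub>G\<^esub> \<triangleleft> f) \<otimes>\<^bsub>G\<^esub> (\<one>\<^bsub>G\<^esub> \<triangleleft> f)"
    using la_distrib[of "\<one>\<^bsub>G\<^esub>" "\<one>\<^bsub>G\<^esub>" f] assms by simp
  then show ?thesis using assms G.r_cancel_one'[of "\<one>\<^bsub>G\<^esub> \<triangleleft> f" "\<one>\<^bsub>G\<^esub> \<triangleleft> f"] by simp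
qed

lemma la_cancel [simp]:
  assumes "g \<in> carrier G" "f \<in> carrier F"
  shows "g \<triangleleft> f \<triangleleft> inv\<^bsub>F\<^esub> f = g" "g \<triangleleft> inv\<^bsub>F\<^esub> f \<triangleleft> f = g"
  using assms by (simp_all flip: la_mult)

lemma ra_cancel [simp]:
  assumes "g \<in> carrier G" "f \<in> carrier F"
  shows "g \<triangleright> inv\<^bsub>G\<^esub> g \<triangleright> f = f" "inv\<^bsub>G\<^esub> g \<triangleright> g \<triangleright> f = f"
  using assms by (simp_all flip: ra_mult)

lemma ra_eq_one [simp]:
  assumes "g \<in> carrier G" "f \<in> carrier F" shows "g \<triangleright> f = \<one>\<^bsub>F\<^esub> \<longleftrightarrow> f = \<one>\<^bsub>F\<^esub>"
  using assms by (metis ra_cancel(2) G.inv_closed ra_fone)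

lemma inv_ra:
  assumes "g \<in> carrier G" "f \<in> carrier F"
  shows "inv\<^bsub>F\<^esub> (g \<triangleright> f) = (g \<triangleleft> f) \<triangleright> inv\<^bsub>F\<^esub> f"
proof -
  have "(g \<triangleright> f) \<otimes>\<^bsub>F\<^esub> ((g \<triangleleft> f) \<triangleright> inv\<^bsub>F\<^esub> f) = \<one>\<^bsub>F\<^esub>"
    using ra_distrib[of g f "inv\<^bsub>F\<^esub> f"] assms by simp
  then show ?thesis
    using assms by (intro F.inv_equality) (auto intro: F.inv_comm)
qed

lemma ra_distrib_la:
  assumes "g \<in> carrier G" "a \<in> carrier F" "f \<in> carrier F"
  shows "(g \<triangleright> a) \<otimes>\<^bsub>F\<^esub> ((g \<triangleleft> a) \<triangleright> (inv\<^bsub>F\<^esub> a \<otimes>\<^bsub>F\<^esub> f)) = g \<triangleright> f"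
  using ra_distrib[of g a "inv\<^bsub>F\<^esub> a \<otimes>\<^bsub>F\<^esub> f"] assms by simp

text \<open>
  The next two identities say that a cocycle does not distinguish the left from the right inverse.  They
  are the cocycle condition at \<open>(f, f\<inverse>, f)\<close> and at \<open>(g, g\<inverse>, g)\<close>, the other two factors being normalised.
\<close>

lemma sigma_inv:
  assumes "g \<in> carrier G" "f \<in> carrier F"
  shows "\<sigma> (g \<triangleleft> f) (inv\<^bsub>F\<^esub> f) f = \<sigma> g f (inv\<^bsub>F\<^esub> f)"
  using sigma_cocycle[of g f "inv\<^bsub>F\<^esub> f" f] assms by simp

lemma tau_inv:
  assumes "g \<in> carrier G" "f \<in> carrier F"
  shows "\<tau> g (inv\<^bsub>G\<^esub> g) (g \<triangleright> f) = \<tau> (inv\<^bsub>G\<^esub> g) g f"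
  using tau_cocycle[of g "inv\<^bsub>G\<^esub> g" g f] assms by simp

section \<open>The structure maps in coordinates\<close>

abbreviation H where "H \<equiv> bicrossed F G (\<triangleleft>) (\<triangleright>) \<sigma> \<tau>"
abbreviation B where "B \<equiv> carrier G \<times> carrier F"

lemma hbasis_H [simp]: "hbasis H = B"
  by (simp add: bicrossed_def)

lemma finite_B: "finite B"
  using finite_F finite_G by simp

abbreviation basis_product where
  "basis_product \<equiv> \<lambda>((g, f), (g', f')).
    if g \<triangleleft> f = g' then \<sigma> g f f' *\<^sub>C bvec (g, f \<otimes>\<^bsub>F\<^esub> f') else 0"

text \<open>
  The structure constants of the product select, for a given \<open>(g, f)\<close>, exactly the factorisations
  \<open>(e\<^sub>g # a) (e\<^bsub>g \<triangleleft> a\<^esub> # a\<inverse> f)\<close>, which are indexed by \<open>a \<in> F\<close>.  The coefficients \<open>\<phi>\<close> are arbitrary, so that the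
  lemma also serves for products in the tensor square.
\<close>

lemma sum_basis_product:
  assumes "g \<in> carrier G" "f \<in> carrier F"
  shows "(\<Sum>q\<in>B \<times> B. \<phi> q * basis_product q (g, f)) =
    (\<Sum>a\<in>carrier F. \<phi> ((g, a), (g \<triangleleft> a, inv\<^bsub>F\<^esub> a \<otimes>\<^bsub>F\<^esub> f)) * \<sigma> g a (inv\<^bsub>F\<^esub> a \<otimes>\<^bsub>F\<^esub> f))"
    (is "?L = ?R")
proof -
  have *: "basis_product ((g1, f1), (g2, f2)) (g, f)
     = (if g1 = g then if g2 = g \<triangleleft> f1 then if f2 = inv\<^bsub>F\<^esub> f1 \<otimes>\<^bsub>F\<^esub> f then \<sigma> g f1 f2 else 0 else 0 else 0)"
    if "g1 \<in> carrier G" "f1 \<in> carrier F" "g2 \<in> carrier G" "f2 \<in> carrier F" for g1 f1 g2 f2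
    using that assms by (auto simp: bvec_apply)
  have "?L = (\<Sum>g1\<in>carrier G. \<Sum>f1\<in>carrier F. \<Sum>g2\<in>carrier G. \<Sum>f2\<in>carrier F. \<phi> ((g1, f1), (g2, f2)) *
      (if g1 = g then if g2 = g \<triangleleft> f1 then if f2 = inv\<^bsub>F\<^esub> f1 \<otimes>\<^bsub>F\<^esub> f then \<sigma> g f1 f2 else 0 else 0 else 0))"
    unfolding sum.cartesian_product' by (intro sum.cong refl) (simp only: *)
  also have "\<dots> = ?R"
    using assms finite_F finite_G by (simp add: if_distrib[of "(*) _"] sum_if_const cong: if_cong)
  finally show ?thesis .
qed

lemma mult_eq_lin_ext: "x \<bullet>\<^bsub>H\<^esub> y = lin_ext (B \<times> B) basis_product (x \<boxtimes> y)"
  by (simp add: bicrossed_def)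

lemma mult_apply:
  assumes "g \<in> carrier G" "f \<in> carrier F"
  shows "(x \<bullet>\<^bsub>H\<^esub> y) (g, f) =
    (\<Sum>a\<in>carrier F. x (g, a) * y (g \<triangleleft> a, inv\<^bsub>F\<^esub> a \<otimes>\<^bsub>F\<^esub> f) * \<sigma> g a (inv\<^bsub>F\<^esub> a \<otimes>\<^bsub>F\<^esub> f))"
  by (simp add: mult_eq_lin_ext lin_ext_apply sum_basis_product[OF assms])

lemma mult_closed: "x \<bullet>\<^bsub>H\<^esub> y \<in> vecs B"
  unfolding vecs_def bicrossed_def
  by (auto simp: lin_ext_apply bvec_apply intro!: sum.neutral)

lemma comult_apply:
  "comult H x ((g\<^sub>1, p), (g\<^sub>2, f)) =
    (if g\<^sub>1 \<in> carrier G \<and> g\<^sub>2 \<in> carrier G \<and> f \<in> carrier F \<and> p = g\<^sub>2 \<triangleright> f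
     then \<tau> g\<^sub>1 g\<^sub>2 f * x (g\<^sub>1 \<otimes>\<^bsub>G\<^esub> g\<^sub>2, f) else 0)"
proof -
  let ?P = "\<lambda>g. {(g', g''). g' \<in> carrier G \<and> g'' \<in> carrier G \<and> g' \<otimes>\<^bsub>G\<^esub> g'' = g}"
  have fin: "finite (?P g)" for g
    by (rule finite_subset[of _ "carrier G \<times> carrier G"]) (auto simp: finite_G)
  have inner: "(\<Sum>(g', g'')\<in>?P g. \<tau> g' g'' f' *\<^sub>C (bvec (g', g'' \<triangleright> f') \<boxtimes> bvec (g'', f'))) ((g\<^sub>1, p), (g\<^sub>2, f)) =
    (if (g\<^sub>1, g\<^sub>2) \<in> ?P g \<and> f' = f \<and> p = g\<^sub>2 \<triangleright> f then \<tau> g\<^sub>1 g\<^sub>2 f else 0)" for g f'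
  proof -
    have "(\<Sum>(g', g'')\<in>?P g. \<tau> g' g'' f' *\<^sub>C (bvec (g', g'' \<triangleright> f') \<boxtimes> bvec (g'', f'))) ((g\<^sub>1, p), (g\<^sub>2, f)) =
      (\<Sum>q\<in>?P g. if q = (g\<^sub>1, g\<^sub>2) then (if f' = f \<and> p = g\<^sub>2 \<triangleright> f then \<tau> g\<^sub>1 g\<^sub>2 f else 0) else 0)"
      unfolding sum_apply by (rule sum.cong) (auto simp: bvec_apply split: if_splits)
    then show ?thesis using fin by (simp add: sum.delta)
  qed
  have "comult H x ((g\<^sub>1, p), (g\<^sub>2, f)) = (\<Sum>b\<in>B. if b = (g\<^sub>1 \<otimes>\<^bsub>G\<^esub> g\<^sub>2, f) then
     (if g\<^sub>1 \<in> carrier G \<and> g\<^sub>2 \<in> carrier G \<and> p = g\<^sub>2 \<triangleright> f then \<tau> g\<^sub>1 g\<^sub>2 f * x b else 0) else 0)"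
    unfolding bicrossed_def by (auto simp: lin_ext_apply inner intro!: sum.cong)
  then show ?thesis using finite_B by (auto simp: sum.delta)
qed

lemma counit_H: "counit H x = (\<Sum>f\<in>carrier F. x (\<one>\<^bsub>G\<^esub>, f))"
proof -
  have "counit H x = (\<Sum>g\<in>carrier G. if g = \<one>\<^bsub>G\<^esub> then \<Sum>f\<in>carrier F. x (g, f) else 0)"
    by (auto simp: bicrossed_def sum.cartesian_product[symmetric] intro!: sum.cong)
  then show ?thesis using finite_G by (simp add: sum.delta)
qed

lemma unit_apply: "hunit H (g, f) = (if g \<in> carrier G \<and> f = \<one>\<^bsub>F\<^esub> then 1 else 0)"
proof -
  have "hunit H (g, f) = (\<Sum>g'\<in>carrier G. if g' = g then (if f = \<one>\<^bsub>F\<^esub> then 1 else 0) else 0)"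
    by (auto simp: bicrossed_def sum_apply bvec_apply intro!: sum.cong)
  then show ?thesis using finite_G by (simp add: sum.delta)
qed

lemma vecs_B_eqI:
  assumes "x \<in> vecs B" "y \<in> vecs B" "\<And>g f. g \<in> carrier G \<Longrightarrow> f \<in> carrier F \<Longrightarrow> x (g, f) = y (g, f)"
  shows "x = y"
proof
  fix b show "x b = y b" using assms by (cases b; cases "b \<in> B") (auto simp: vecs_def)
qed

lemma sum_F_shift: "c \<in> carrier F \<Longrightarrow> (\<Sum>a\<in>carrier F. \<phi> (c \<otimes>\<^bsub>F\<^esub> a)) = (\<Sum>a\<in>carrier F. \<phi> a)"
  by (rule sum.reindex_bij_witness[where i="\<lambda>a. inv\<^bsub>F\<^esub> c \<otimes>\<^bsub>F\<^esub> a" and j="\<lambda>a. c \<otimes>\<^bsub>F\<^esub> a"]) auto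

section \<open>The bicrossed product is a Hopf algebra\<close>

lemma mult_bvec: "b \<in> B \<Longrightarrow> c \<in> B \<Longrightarrow> bvec b \<bullet>\<^bsub>H\<^esub> bvec c = basis_product (b, c)"
proof (rule ext)
  fix i assume bc: "b \<in> B" "c \<in> B"
  have "(bvec b \<bullet>\<^bsub>H\<^esub> bvec c) i = (\<Sum>q\<in>B \<times> B. basis_product q i * bvec q (b, c))"
    unfolding mult_eq_lin_ext lin_ext_apply by (rule sum.cong) (auto simp: bvec_apply split: if_splits)
  then show "(bvec b \<bullet>\<^bsub>H\<^esub> bvec c) i = basis_product (b, c) i"
    using bc finite_B by (simp add: sum_bvec del: mem_Sigma_iff add: SigmaI)
qed

lemma mult_add_left: "(x + x') \<bullet>\<^bsub>H\<^esub> y = x \<bullet>\<^bsub>H\<^esub> y + x' \<bullet>\<^bsub>H\<^esub> y"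
  and mult_add_right: "x \<bullet>\<^bsub>H\<^esub> (y + y') = x \<bullet>\<^bsub>H\<^esub> y + x \<bullet>\<^bsub>H\<^esub> y'"
  and mult_scale_left: "(c *\<^sub>C x) \<bullet>\<^bsub>H\<^esub> y = c *\<^sub>C (x \<bullet>\<^bsub>H\<^esub> y)"
  and mult_scale_right: "x \<bullet>\<^bsub>H\<^esub> (c *\<^sub>C y) = c *\<^sub>C (x \<bullet>\<^bsub>H\<^esub> y)"
proof -
  have "(x + x') \<boxtimes> y = x \<boxtimes> y + x' \<boxtimes> y" "x \<boxtimes> (y + y') = x \<boxtimes> y + x \<boxtimes> y'"
    "(c *\<^sub>C x) \<boxtimes> y = c *\<^sub>C (x \<boxtimes> y)" "x \<boxtimes> (c *\<^sub>C y) = c *\<^sub>C (x \<boxtimes> y)"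
    by (auto simp: tensor_def algebra_simps)
  then show "(x + x') \<bullet>\<^bsub>H\<^esub> y = x \<bullet>\<^bsub>H\<^esub> y + x' \<bullet>\<^bsub>H\<^esub> y" "x \<bullet>\<^bsub>H\<^esub> (y + y') = x \<bullet>\<^bsub>H\<^esub> y + x \<bullet>\<^bsub>H\<^esub> y'"
    "(c *\<^sub>C x) \<bullet>\<^bsub>H\<^esub> y = c *\<^sub>C (x \<bullet>\<^bsub>H\<^esub> y)" "x \<bullet>\<^bsub>H\<^esub> (c *\<^sub>C y) = c *\<^sub>C (x \<bullet>\<^bsub>H\<^esub> y)"
    by (simp_all add: mult_eq_lin_ext lin_ext_add lin_ext_scale)
qed

lemma mult_assoc: "(x \<bullet>\<^bsub>H\<^esub> y) \<bullet>\<^bsub>H\<^esub> z = x \<bullet>\<^bsub>H\<^esub> (y \<bullet>\<^bsub>H\<^esub> z)"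
proof (rule vecs_B_eqI)
  fix g f assume gf [simp]: "g \<in> carrier G" "f \<in> carrier F"
  let ?t = "\<lambda>a b. x (g, a) * y (g \<triangleleft> a, inv\<^bsub>F\<^esub> a \<otimes>\<^bsub>F\<^esub> b) * z (g \<triangleleft> b, inv\<^bsub>F\<^esub> b \<otimes>\<^bsub>F\<^esub> f) *
    (\<sigma> g a (inv\<^bsub>F\<^esub> a \<otimes>\<^bsub>F\<^esub> b) * \<sigma> g b (inv\<^bsub>F\<^esub> b \<otimes>\<^bsub>F\<^esub> f))"
  have "((x \<bullet>\<^bsub>H\<^esub> y) \<bullet>\<^bsub>H\<^esub> z) (g, f) = (\<Sum>b\<in>carrier F. \<Sum>a\<in>carrier F. ?t a b)"
    by (simp add: mult_apply sum_distrib_left sum_distrib_right ac_simps)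
  also have "\<dots> = (\<Sum>a\<in>carrier F. \<Sum>b\<in>carrier F. ?t a b)"
    by (rule sum.swap)
  also have "\<dots> = (x \<bullet>\<^bsub>H\<^esub> (y \<bullet>\<^bsub>H\<^esub> z)) (g, f)"
  proof -
    have "(\<Sum>b\<in>carrier F. ?t a b) =
      x (g, a) * (y \<bullet>\<^bsub>H\<^esub> z) (g \<triangleleft> a, inv\<^bsub>F\<^esub> a \<otimes>\<^bsub>F\<^esub> f) * \<sigma> g a (inv\<^bsub>F\<^esub> a \<otimes>\<^bsub>F\<^esub> f)"
      if [simp]: "a \<in> carrier F" for a
    proof -
      have "(\<Sum>b\<in>carrier F. ?t a b) = (\<Sum>c\<in>carrier F. ?t a (a \<otimes>\<^bsub>F\<^esub> c))"
        by (rule sum_F_shift[symmetric]) simp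
      also have "\<dots> = (\<Sum>c\<in>carrier F. x (g, a) * (y (g \<triangleleft> a, c) *
          z (g \<triangleleft> a \<triangleleft> c, inv\<^bsub>F\<^esub> c \<otimes>\<^bsub>F\<^esub> (inv\<^bsub>F\<^esub> a \<otimes>\<^bsub>F\<^esub> f)) *
          \<sigma> (g \<triangleleft> a) c (inv\<^bsub>F\<^esub> c \<otimes>\<^bsub>F\<^esub> (inv\<^bsub>F\<^esub> a \<otimes>\<^bsub>F\<^esub> f))) * \<sigma> g a (inv\<^bsub>F\<^esub> a \<otimes>\<^bsub>F\<^esub> f))"
      proof (rule sum.cong[OF refl])
        fix c assume [simp]: "c \<in> carrier F"
        show "?t a (a \<otimes>\<^bsub>F\<^esub> c) = x (g, a) * (y (g \<triangleleft> a, c) *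
          z (g \<triangleleft> a \<triangleleft> c, inv\<^bsub>F\<^esub> c \<otimes>\<^bsub>F\<^esub> (inv\<^bsub>F\<^esub> a \<otimes>\<^bsub>F\<^esub> f)) *
          \<sigma> (g \<triangleleft> a) c (inv\<^bsub>F\<^esub> c \<otimes>\<^bsub>F\<^esub> (inv\<^bsub>F\<^esub> a \<otimes>\<^bsub>F\<^esub> f))) * \<sigma> g a (inv\<^bsub>F\<^esub> a \<otimes>\<^bsub>F\<^esub> f)"
          using sigma_cocycle[of g a c "inv\<^bsub>F\<^esub> c \<otimes>\<^bsub>F\<^esub> (inv\<^bsub>F\<^esub> a \<otimes>\<^bsub>F\<^esub> f)"]
          by (simp add: F.inv_mult_group F.m_assoc la_mult)
      qed
      finally show ?thesis
        by (simp add: mult_apply sum_distrib_left sum_distrib_right)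
    qed
    then show ?thesis by (simp add: mult_apply)
  qed
  finally show "((x \<bullet>\<^bsub>H\<^esub> y) \<bullet>\<^bsub>H\<^esub> z) (g, f) = (x \<bullet>\<^bsub>H\<^esub> (y \<bullet>\<^bsub>H\<^esub> z)) (g, f)" .
qed (rule mult_closed)+

lemma unit_closed: "hunit H \<in> vecs B"
  by (auto simp: vecs_def unit_apply)

lemma unit_left: "x \<in> vecs B \<Longrightarrow> hunit H \<bullet>\<^bsub>H\<^esub> x = x"
  by (rule vecs_B_eqI[OF mult_closed])
    (simp_all add: mult_apply unit_apply if_distrib[of "\<lambda>u. u * _"] finite_F cong: if_cong)

lemma unit_right:
  assumes "x \<in> vecs B" shows "x \<bullet>\<^bsub>H\<^esub> hunit H = x"
proof (rule vecs_B_eqI[OF mult_closed assms])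
  fix g f assume gf [simp]: "g \<in> carrier G" "f \<in> carrier F"
  have "(x \<bullet>\<^bsub>H\<^esub> hunit H) (g, f) = (\<Sum>a\<in>carrier F. if a = f then x (g, f) else 0)"
    unfolding mult_apply[OF gf] unit_apply
  proof (intro sum.cong refl)
    fix a assume [simp]: "a \<in> carrier F"
    have "inv\<^bsub>F\<^esub> a \<otimes>\<^bsub>F\<^esub> f = \<one>\<^bsub>F\<^esub> \<longleftrightarrow> a = f"
      by (metis F.inv_closed F.inv_solve_left F.r_one F.one_closed \<open>a \<in> carrier F\<close> gf(2))
    then show "x (g, a) * (if g \<triangleleft> a \<in> carrier G \<and> inv\<^bsub>F\<^esub> a \<otimes>\<^bsub>F\<^esub> f = \<one>\<^bsub>F\<^esub> then 1 else 0) *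
        \<sigma> g a (inv\<^bsub>F\<^esub> a \<otimes>\<^bsub>F\<^esub> f) = (if a = f then x (g, f) else 0)"
      by simp
  qed
  then show "(x \<bullet>\<^bsub>H\<^esub> hunit H) (g, f) = x (g, f)" by (simp add: finite_F)
qed

lemma algebra_H: "algebra_axioms H"
  by (auto simp: algebra_axioms_def linear_on_def mult_closed mult_assoc unit_closed unit_left unit_right
      mult_add_left mult_add_right mult_scale_left mult_scale_right)

lemma comult_closed: "comult H x \<in> vecs (B \<times> B)"
  by (auto simp: vecs_def comult_apply)

lemma comult_add: "comult H (x + y) = comult H x + comult H y"
  and comult_scale: "comult H (c *\<^sub>C x) = c *\<^sub>C comult H x"
  by (simp_all add: bicrossed_def lin_ext_add lin_ext_scale)

lemma counit_add: "counit H (x + y) = counit H x + counit H y"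
  and counit_scale: "counit H (c *\<^sub>C x) = c * counit H x"
  by (simp_all add: counit_H sum.distrib sum_distrib_left)

lemma counit_bvec: "(g, f) \<in> B \<Longrightarrow> counit H (bvec (g, f)) = (if g = \<one>\<^bsub>G\<^esub> then 1 else 0)"
  by (auto simp: counit_H bvec_apply finite_F)

lemma sum_bvec_mult: "finite A \<Longrightarrow> c \<in> A \<Longrightarrow> (\<Sum>b\<in>A. \<phi> b * (\<psi> b * bvec b c)) = \<phi> c * \<psi> c"
  using sum_bvec[of A c "\<lambda>b. \<phi> b * \<psi> b"] by (simp add: mult.assoc)

lemma sum_comult_bvec:
  "(\<Sum>d\<in>B. \<phi> d * comult H (bvec d) ((g\<^sub>1, p), (g\<^sub>2, f))) =
    (if g\<^sub>1 \<in> carrier G \<and> g\<^sub>2 \<in> carrier G \<and> f \<in> carrier F \<and> p = g\<^sub>2 \<triangleright> f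
     then \<tau> g\<^sub>1 g\<^sub>2 f * \<phi> (g\<^sub>1 \<otimes>\<^bsub>G\<^esub> g\<^sub>2, f) else 0)"
proof (cases "g\<^sub>1 \<in> carrier G \<and> g\<^sub>2 \<in> carrier G \<and> f \<in> carrier F \<and> p = g\<^sub>2 \<triangleright> f")
  case True
  then have "(g\<^sub>1 \<otimes>\<^bsub>G\<^esub> g\<^sub>2, f) \<in> B" by simp
  then show ?thesis using True sum_bvec_mult[OF finite_B] by (simp add: comult_apply)
qed (auto simp: comult_apply)

lemma comult_bvec_sum_left:
  assumes "c \<in> B"
  shows "lin_ext (B \<times> B) (\<lambda>(u, v). comult H (bvec u) \<boxtimes> bvec v) w (((g\<^sub>1, p), (g\<^sub>2, f)), c) =
    (if g\<^sub>1 \<in> carrier G \<and> g\<^sub>2 \<in> carrier G \<and> f \<in> carrier F \<and> p = g\<^sub>2 \<triangleright> f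
     then \<tau> g\<^sub>1 g\<^sub>2 f * w ((g\<^sub>1 \<otimes>\<^bsub>G\<^esub> g\<^sub>2, f), c) else 0)"
  unfolding lin_ext_apply sum.cartesian_product'[of _ B B]
  by (simp add: sum_bvec_mult[OF finite_B assms] sum_comult_bvec)

lemma comult_bvec_sum_right:
  assumes "a \<in> B"
  shows "lin_ext (B \<times> B) (\<lambda>(u, v). bvec u \<boxtimes> comult H (bvec v)) w (a, ((g\<^sub>1, p), (g\<^sub>2, f))) =
    (if g\<^sub>1 \<in> carrier G \<and> g\<^sub>2 \<in> carrier G \<and> f \<in> carrier F \<and> p = g\<^sub>2 \<triangleright> f
     then \<tau> g\<^sub>1 g\<^sub>2 f * w (a, (g\<^sub>1 \<otimes>\<^bsub>G\<^esub> g\<^sub>2, f)) else 0)"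
proof -
  have "lin_ext (B \<times> B) (\<lambda>(u, v). bvec u \<boxtimes> comult H (bvec v)) w (a, ((g\<^sub>1, p), (g\<^sub>2, f))) =
    (\<Sum>v\<in>B. \<Sum>u\<in>B. w (u, v) * (comult H (bvec v) ((g\<^sub>1, p), (g\<^sub>2, f)) * bvec u a))"
    unfolding lin_ext_apply sum.cartesian_product'[of _ B B]
    by (subst sum.swap) (simp add: mult.commute)
  then show ?thesis
    by (simp only: sum_bvec_mult[OF finite_B assms] sum_comult_bvec)
qed

lemma comult_coassoc:
  "lin_ext (B \<times> B) (\<lambda>(u, v). comult H (bvec u) \<boxtimes> bvec v) (comult H x) ((a, b), c) =
   lin_ext (B \<times> B) (\<lambda>(u, v). bvec u \<boxtimes> comult H (bvec v)) (comult H x) (a, (b, c))"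
proof (cases "a \<in> B \<and> b \<in> B \<and> c \<in> B")
  case True
  obtain a1 a2 b1 b2 c1 c2 where abc: "a = (a1, a2)" "b = (b1, b2)" "c = (c1, c2)"
    by (cases a; cases b; cases c)
  then have [simp]: "a1 \<in> carrier G" "a2 \<in> carrier F" "b1 \<in> carrier G" "b2 \<in> carrier F"
     "c1 \<in> carrier G" "c2 \<in> carrier F" using True by auto
  show ?thesis
    using tau_cocycle[of a1 b1 c1 c2]
    by (auto simp: abc comult_bvec_sum_left comult_bvec_sum_right comult_apply ra_mult G.m_assoc mult.commute)
next
  case False
  have supp: "p \<in> B \<and> q \<in> B" if "comult H y (p, q) \<noteq> 0" for y p q
    using that comult_closed[of y] vecs_zero_outside[of "comult H y" "B \<times> B" "(p, q)"] by blast
  have "lin_ext (B \<times> B) (\<lambda>(u, v). comult H (bvec u) \<boxtimes> bvec v) (comult H x) ((a, b), c) = 0"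
    unfolding lin_ext_apply using False
    by (intro sum.neutral) (auto simp: bvec_apply simp del: mem_Sigma_iff split: if_splits dest!: supp)
  moreover have "lin_ext (B \<times> B) (\<lambda>(u, v). bvec u \<boxtimes> comult H (bvec v)) (comult H x) (a, (b, c)) = 0"
    unfolding lin_ext_apply using False
    by (intro sum.neutral) (auto simp: bvec_apply simp del: mem_Sigma_iff split: if_splits dest!: supp)
  ultimately show ?thesis by simp
qed

lemma counit_left:
  assumes "x \<in> vecs B"
  shows "lin_ext (B \<times> B) (\<lambda>(u, v). counit H (bvec u) *\<^sub>C bvec v) (comult H x) = x"
proof (rule vecs_B_eqI)
  fix g f assume gf: "g \<in> carrier G" "f \<in> carrier F"
  then have "(g, f) \<in> B" by simp
  then have "lin_ext (B \<times> B) (\<lambda>(u, v). counit H (bvec u) *\<^sub>C bvec v) (comult H x) (g, f) =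
    (\<Sum>u\<in>B. comult H x (u, (g, f)) * counit H (bvec u))"
    unfolding lin_ext_apply sum.cartesian_product'[of _ B B]
    by (simp add: sum_bvec_mult[OF finite_B])
  also have "\<dots> = (\<Sum>u\<in>B. if u = (\<one>\<^bsub>G\<^esub>, g \<triangleright> f) then x (g, f) else 0)"
    using gf by (intro sum.cong) (auto simp: comult_apply counit_bvec split: if_splits)
  finally show "lin_ext (B \<times> B) (\<lambda>(u, v). counit H (bvec u) *\<^sub>C bvec v) (comult H x) (g, f) = x (g, f)"
    using gf finite_B by simp
qed (use assms in \<open>auto simp: vecs_def lin_ext_apply bvec_apply intro!: sum.neutral\<close>)

lemma sum_comult_counit:
  assumes "a \<in> B" shows "(\<Sum>v\<in>B. comult H x (a, v) * counit H (bvec v)) = x a"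
proof -
  obtain g f where a: "a = (g, f)" "g \<in> carrier G" "f \<in> carrier F" using assms by auto
  have "(\<Sum>v\<in>B. comult H x ((g, f), v) * counit H (bvec v)) =
    (\<Sum>v\<in>B. if v = (\<one>\<^bsub>G\<^esub>, f) then x (g, f) else 0)"
    using a by (intro sum.cong) (auto simp: comult_apply counit_bvec split: if_splits)
  then show ?thesis using a finite_B by simp
qed

lemma counit_right:
  assumes "x \<in> vecs B"
  shows "lin_ext (B \<times> B) (\<lambda>(u, v). counit H (bvec v) *\<^sub>C bvec u) (comult H x) = x"
proof (rule vecs_B_eqI)
  fix g f assume "g \<in> carrier G" "f \<in> carrier F"
  then have gf: "(g, f) \<in> B" by simp
  then show "lin_ext (B \<times> B) (\<lambda>(u, v). counit H (bvec v) *\<^sub>C bvec u) (comult H x) (g, f) = x (g, f)"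
    unfolding lin_ext_apply sum.cartesian_product'[of _ B B]
    by (subst sum.swap) (simp add: sum_bvec_mult[OF finite_B] sum_comult_counit[OF gf])
qed (use assms in \<open>auto simp: vecs_def lin_ext_apply bvec_apply intro!: sum.neutral\<close>)

lemma coalgebra_H: "coalgebra_axioms H"
  by (auto simp: coalgebra_axioms_def linear_on_def comult_closed comult_add comult_scale counit_add
      counit_scale comult_coassoc counit_left counit_right)

lemma tensor_mult_apply:
  assumes "g\<^sub>1 \<in> carrier G" "p \<in> carrier F" "g\<^sub>2 \<in> carrier G" "f \<in> carrier F"
  shows "tensor_mult H w z ((g\<^sub>1, p), (g\<^sub>2, f)) =
    (\<Sum>b\<in>carrier F. \<Sum>a\<in>carrier F. w ((g\<^sub>1, a), (g\<^sub>2, b)) *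
      z ((g\<^sub>1 \<triangleleft> a, inv\<^bsub>F\<^esub> a \<otimes>\<^bsub>F\<^esub> p), (g\<^sub>2 \<triangleleft> b, inv\<^bsub>F\<^esub> b \<otimes>\<^bsub>F\<^esub> f)) *
      \<sigma> g\<^sub>1 a (inv\<^bsub>F\<^esub> a \<otimes>\<^bsub>F\<^esub> p) * \<sigma> g\<^sub>2 b (inv\<^bsub>F\<^esub> b \<otimes>\<^bsub>F\<^esub> f))"
proof -
  have "tensor_mult H w z ((g\<^sub>1, p), (g\<^sub>2, f)) =
    (\<Sum>a\<in>B. \<Sum>b\<in>B. \<Sum>c\<in>B. \<Sum>d\<in>B.
      w (a, b) * z (c, d) * basis_product (a, c) (g\<^sub>1, p) * basis_product (b, d) (g\<^sub>2, f))"
    unfolding tensor_mult_def lin_ext_apply hbasis_H sum.cartesian_product'[of _ "B \<times> B" "B \<times> B"]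
      sum.cartesian_product'[of _ B B]
    by (intro sum.cong refl) (simp only: mult_bvec tensor_apply prod.case mult.assoc)
  also have "\<dots> = (\<Sum>a\<in>B. \<Sum>c\<in>B. \<Sum>b\<in>B. \<Sum>d\<in>B.
      w (a, b) * z (c, d) * basis_product (a, c) (g\<^sub>1, p) * basis_product (b, d) (g\<^sub>2, f))"
    by (rule sum.cong[OF refl]) (rule sum.swap)
  also have "\<dots> = (\<Sum>q\<in>B \<times> B. (\<Sum>r\<in>B \<times> B. (w (fst q, fst r) * z (snd q, snd r)) *
      basis_product r (g\<^sub>2, f)) * basis_product q (g\<^sub>1, p))"
    unfolding sum.cartesian_product'[of _ B B] sum_distrib_right fst_conv snd_conv
    by (intro sum.cong refl) (simp only: mult_ac)
  also have "\<dots> = (\<Sum>a\<in>carrier F. \<Sum>b\<in>carrier F. w ((g\<^sub>1, a), (g\<^sub>2, b)) *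
      z ((g\<^sub>1 \<triangleleft> a, inv\<^bsub>F\<^esub> a \<otimes>\<^bsub>F\<^esub> p), (g\<^sub>2 \<triangleleft> b, inv\<^bsub>F\<^esub> b \<otimes>\<^bsub>F\<^esub> f)) *
      \<sigma> g\<^sub>1 a (inv\<^bsub>F\<^esub> a \<otimes>\<^bsub>F\<^esub> p) * \<sigma> g\<^sub>2 b (inv\<^bsub>F\<^esub> b \<otimes>\<^bsub>F\<^esub> f))"
    unfolding sum_basis_product[OF assms(3,4)] sum_basis_product[OF assms(1,2)]
    unfolding sum_distrib_right fst_conv snd_conv by (simp only: mult_ac)
  also have "\<dots> = (\<Sum>b\<in>carrier F. \<Sum>a\<in>carrier F. w ((g\<^sub>1, a), (g\<^sub>2, b)) *
      z ((g\<^sub>1 \<triangleleft> a, inv\<^bsub>F\<^esub> a \<otimes>\<^bsub>F\<^esub> p), (g\<^sub>2 \<triangleleft> b, inv\<^bsub>F\<^esub> b \<otimes>\<^bsub>F\<^esub> f)) *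
      \<sigma> g\<^sub>1 a (inv\<^bsub>F\<^esub> a \<otimes>\<^bsub>F\<^esub> p) * \<sigma> g\<^sub>2 b (inv\<^bsub>F\<^esub> b \<otimes>\<^bsub>F\<^esub> f))"
    by (rule sum.swap)
  finally show ?thesis .
qed

lemma tensor_mult_closed: "tensor_mult H w z \<in> vecs (B \<times> B)"
  unfolding vecs_def
proof (intro CollectI allI impI)
  fix i assume i: "i \<notin> B \<times> B"
  obtain p q where pq: "i = (p, q)" by (cases i)
  have "(bvec a \<bullet>\<^bsub>H\<^esub> bvec c) p = 0 \<or> (bvec b \<bullet>\<^bsub>H\<^esub> bvec d) q = 0" for a b c d
    using i pq mult_closed vecs_zero_outside by (metis SigmaI)
  then show "tensor_mult H w z i = 0"
    unfolding tensor_mult_def lin_ext_apply pq by (intro sum.neutral ballI) (simp split: prod.split)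
qed

text \<open>
  A tensor \<open>(g\<^sub>1, p) \<otimes> (g\<^sub>2, f)\<close> of basis vectors occurs in a coproduct only if \<open>p = g\<^sub>2 \<triangleright> f\<close>.  If the first factor
  of a product of two such tensors has this property, the second has it exactly when the product does.
\<close>

lemma ra_divides_iff:
  assumes "g \<in> carrier G" "a \<in> carrier F" "f \<in> carrier F" "p \<in> carrier F"
  shows "inv\<^bsub>F\<^esub> (g \<triangleright> a) \<otimes>\<^bsub>F\<^esub> p = (g \<triangleleft> a) \<triangleright> (inv\<^bsub>F\<^esub> a \<otimes>\<^bsub>F\<^esub> f) \<longleftrightarrow> p = g \<triangleright> f"
  using assms ra_distrib_la[of g a f] by (metis F_cancel F.inv_closed F.m_closed ra_closed la_closed)

text \<open>
  For fixed \<open>b\<close> the sum over \<open>a\<close> has only the term \<open>a = g\<^sub>2 \<triangleright> b\<close>, and the scalars of that term agree by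
  the compatibility of \<open>\<sigma>\<close> and \<open>\<tau>\<close>.
\<close>

lemma comult_mult: "comult H (x \<bullet>\<^bsub>H\<^esub> y) = tensor_mult H (comult H x) (comult H y)"
proof
  fix i :: "('g \<times> 'f) \<times> ('g \<times> 'f)"
  obtain g\<^sub>1 p g\<^sub>2 f where i: "i = ((g\<^sub>1, p), (g\<^sub>2, f))" by (metis surj_pair)
  show "comult H (x \<bullet>\<^bsub>H\<^esub> y) i = tensor_mult H (comult H x) (comult H y) i"
  proof (cases "i \<in> B \<times> B")
    case False
    then show ?thesis
      using comult_closed tensor_mult_closed vecs_zero_outside by metis
  next
    case True
    then have [simp]: "g\<^sub>1 \<in> carrier G" "p \<in> carrier F" "g\<^sub>2 \<in> carrier G" "f \<in> carrier F"
      by (auto simp: i)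
    let ?w = "comult H x" and ?z = "comult H y"
    have "(\<Sum>a\<in>carrier F. ?w ((g\<^sub>1, a), (g\<^sub>2, b)) *
        ?z ((g\<^sub>1 \<triangleleft> a, inv\<^bsub>F\<^esub> a \<otimes>\<^bsub>F\<^esub> p), (g\<^sub>2 \<triangleleft> b, inv\<^bsub>F\<^esub> b \<otimes>\<^bsub>F\<^esub> f)) *
        \<sigma> g\<^sub>1 a (inv\<^bsub>F\<^esub> a \<otimes>\<^bsub>F\<^esub> p) * \<sigma> g\<^sub>2 b (inv\<^bsub>F\<^esub> b \<otimes>\<^bsub>F\<^esub> f)) =
      (if p = g\<^sub>2 \<triangleright> f then \<tau> g\<^sub>1 g\<^sub>2 f * (x (g\<^sub>1 \<otimes>\<^bsub>G\<^esub> g\<^sub>2, b) *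
        y ((g\<^sub>1 \<otimes>\<^bsub>G\<^esub> g\<^sub>2) \<triangleleft> b, inv\<^bsub>F\<^esub> b \<otimes>\<^bsub>F\<^esub> f) * \<sigma> (g\<^sub>1 \<otimes>\<^bsub>G\<^esub> g\<^sub>2) b (inv\<^bsub>F\<^esub> b \<otimes>\<^bsub>F\<^esub> f)) else 0)"
      (is "sum ?t _ = ?r") if [simp]: "b \<in> carrier F" for b
    proof -
      have "sum ?t (carrier F) = (\<Sum>a\<in>carrier F. if a = g\<^sub>2 \<triangleright> b then ?t (g\<^sub>2 \<triangleright> b) else 0)"
        by (rule sum.cong) (auto simp: comult_apply)
      also have "\<dots> = ?t (g\<^sub>2 \<triangleright> b)" by (simp add: finite_F)
      also have "\<dots> = ?r"
      proof (cases "p = g\<^sub>2 \<triangleright> f")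
        case p: True
        have q: "inv\<^bsub>F\<^esub> (g\<^sub>2 \<triangleright> b) \<otimes>\<^bsub>F\<^esub> p = (g\<^sub>2 \<triangleleft> b) \<triangleright> (inv\<^bsub>F\<^esub> b \<otimes>\<^bsub>F\<^esub> f)"
          using p by (simp add: ra_divides_iff)
        show ?thesis
          using sigma_tau_compatible[of g\<^sub>1 g\<^sub>2 b "inv\<^bsub>F\<^esub> b \<otimes>\<^bsub>F\<^esub> f"]
          by (simp only: q) (simp add: comult_apply la_distrib p ac_simps)
      qed (simp add: comult_apply ra_divides_iff)
      finally show ?thesis .
    qed
    then show ?thesis
      by (simp add: i tensor_mult_apply comult_apply mult_apply sum_if_const sum_distrib_left)
  qed
qed

lemma counit_mult: "counit H (x \<bullet>\<^bsub>H\<^esub> y) = counit H x * counit H y"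
proof -
  have "counit H (x \<bullet>\<^bsub>H\<^esub> y) = (\<Sum>a\<in>carrier F. \<Sum>f\<in>carrier F. x (\<one>\<^bsub>G\<^esub>, a) * y (\<one>\<^bsub>G\<^esub>, inv\<^bsub>F\<^esub> a \<otimes>\<^bsub>F\<^esub> f))"
    unfolding counit_H by (subst sum.swap) (simp add: mult_apply)
  also have "\<dots> = (\<Sum>a\<in>carrier F. \<Sum>f\<in>carrier F. x (\<one>\<^bsub>G\<^esub>, a) * y (\<one>\<^bsub>G\<^esub>, f))"
    by (intro sum.cong refl sum_F_shift) auto
  finally show ?thesis by (simp add: counit_H sum_product)
qed

lemma comult_unit: "comult H (hunit H) = hunit H \<boxtimes> hunit H"
proof
  fix i :: "('g \<times> 'f) \<times> ('g \<times> 'f)"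
  obtain g\<^sub>1 p g\<^sub>2 f where i: "i = ((g\<^sub>1, p), (g\<^sub>2, f))" by (metis surj_pair)
  show "comult H (hunit H) i = (hunit H \<boxtimes> hunit H) i"
    by (auto simp: i comult_apply unit_apply)
qed

lemma counit_unit: "counit H (hunit H) = 1"
  by (simp add: counit_H unit_apply finite_F)

lemma bialgebra_H: "bialgebra H"
  using finite_B
  by (simp add: bialgebra_def algebra_H coalgebra_H comult_mult counit_mult comult_unit counit_unit)

section \<open>The antipode\<close>

text \<open>
  The formula \<open>S(e\<^sub>g # f) = \<sigma>(g\<inverse>; g \<triangleright> f, (g \<triangleright> f)\<inverse>)\<inverse> \<tau>(g\<inverse>, g; f)\<inverse> e\<^bsub>(g \<triangleleft> f)\<inverse>\<^esub> # (g \<triangleright> f)\<inverse>\<close>, read coordinatewise.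
  The map \<open>(g, f) \<mapsto> ((g \<triangleleft> f)\<inverse>, (g \<triangleright> f)\<inverse>)\<close> is an involution, hence the same expression occurs on the side of the
  argument.
\<close>

definition S :: "('g \<times> 'f) vec \<Rightarrow> ('g \<times> 'f) vec" where
  "S x = (\<lambda>(g, f). if (g, f) \<in> B
    then x (inv\<^bsub>G\<^esub> (g \<triangleleft> f), inv\<^bsub>F\<^esub> (g \<triangleright> f)) /
      (\<sigma> g f (inv\<^bsub>F\<^esub> f) * \<tau> (inv\<^bsub>G\<^esub> (g \<triangleleft> f)) (g \<triangleleft> f) (inv\<^bsub>F\<^esub> f))
    else 0)"

text \<open>
  At the point \<open>(k \<triangleleft> q, q\<inverse>)\<close>, where \<open>k\<close> and \<open>q\<close> are arbitrary, the inverses simplify, and the involution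
  reads off the coordinate at \<open>(k, q)\<close> there as well; this is the form in which the antipode and the involution are compared.
\<close>

lemma S_apply:
  assumes "k \<in> carrier G" "q \<in> carrier F"
  shows "S x (k \<triangleleft> q, inv\<^bsub>F\<^esub> q) = x (inv\<^bsub>G\<^esub> k, k \<triangleright> q) / (\<sigma> k q (inv\<^bsub>F\<^esub> q) * \<tau> (inv\<^bsub>G\<^esub> k) k q)"
  using assms sigma_inv[of k q] by (simp add: S_def flip: inv_ra)

text \<open>
  The convolution of an arbitrary family \<open>T\<close> with the identity.  Keeping \<open>T\<close> arbitrary allows the lemma to
  be used twice: to verify the antipode equation for \<open>S\<close>, and to show that it determines every antipode.
\<close>

lemma left_convolution:
  assumes [simp]: "h \<in> carrier G" "k \<in> carrier F"
  shows "lin_ext (B \<times> B) (\<lambda>(u, v). T u \<bullet>\<^bsub>H\<^esub> bvec v) (comult H x) (h, k) =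
    (\<Sum>a\<in>carrier F. \<Sum>u\<in>carrier G. \<tau> u (h \<triangleleft> a) (inv\<^bsub>F\<^esub> a \<otimes>\<^bsub>F\<^esub> k) *
      x (u \<otimes>\<^bsub>G\<^esub> (h \<triangleleft> a), inv\<^bsub>F\<^esub> a \<otimes>\<^bsub>F\<^esub> k) *
      T (u, (h \<triangleleft> a) \<triangleright> (inv\<^bsub>F\<^esub> a \<otimes>\<^bsub>F\<^esub> k)) (h, a) * \<sigma> h a (inv\<^bsub>F\<^esub> a \<otimes>\<^bsub>F\<^esub> k))"
proof -
  have "lin_ext (B \<times> B) (\<lambda>(u, v). T u \<bullet>\<^bsub>H\<^esub> bvec v) (comult H x) (h, k) =
    (\<Sum>u\<in>B. \<Sum>v\<in>B. \<Sum>a\<in>carrier F. comult H x (u, v) *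
      (T u (h, a) * \<sigma> h a (inv\<^bsub>F\<^esub> a \<otimes>\<^bsub>F\<^esub> k) * bvec v (h \<triangleleft> a, inv\<^bsub>F\<^esub> a \<otimes>\<^bsub>F\<^esub> k)))"
    unfolding lin_ext_apply sum.cartesian_product'[of _ B B]
    by (simp add: mult_apply sum_distrib_left mult_ac)
  also have "\<dots> = (\<Sum>u\<in>B. \<Sum>a\<in>carrier F. \<Sum>v\<in>B. comult H x (u, v) *
      (T u (h, a) * \<sigma> h a (inv\<^bsub>F\<^esub> a \<otimes>\<^bsub>F\<^esub> k) * bvec v (h \<triangleleft> a, inv\<^bsub>F\<^esub> a \<otimes>\<^bsub>F\<^esub> k)))"
    by (rule sum.cong[OF refl]) (rule sum.swap)
  also have "\<dots> = (\<Sum>u\<in>B. \<Sum>a\<in>carrier F. comult H x (u, (h \<triangleleft> a, inv\<^bsub>F\<^esub> a \<otimes>\<^bsub>F\<^esub> k)) *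
      (T u (h, a) * \<sigma> h a (inv\<^bsub>F\<^esub> a \<otimes>\<^bsub>F\<^esub> k)))"
    using finite_B by (intro sum.cong refl sum_bvec_mult) auto
  also have "\<dots> = (\<Sum>a\<in>carrier F. \<Sum>u\<in>B. comult H x (u, (h \<triangleleft> a, inv\<^bsub>F\<^esub> a \<otimes>\<^bsub>F\<^esub> k)) *
      (T u (h, a) * \<sigma> h a (inv\<^bsub>F\<^esub> a \<otimes>\<^bsub>F\<^esub> k)))"
    by (rule sum.swap)
  also have "\<dots> = (\<Sum>a\<in>carrier F. \<Sum>u\<in>carrier G. \<tau> u (h \<triangleleft> a) (inv\<^bsub>F\<^esub> a \<otimes>\<^bsub>F\<^esub> k) *
      x (u \<otimes>\<^bsub>G\<^esub> (h \<triangleleft> a), inv\<^bsub>F\<^esub> a \<otimes>\<^bsub>F\<^esub> k) *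
      T (u, (h \<triangleleft> a) \<triangleright> (inv\<^bsub>F\<^esub> a \<otimes>\<^bsub>F\<^esub> k)) (h, a) * \<sigma> h a (inv\<^bsub>F\<^esub> a \<otimes>\<^bsub>F\<^esub> k))"
  proof (rule sum.cong[OF refl])
    fix a assume [simp]: "a \<in> carrier F"
    let ?c = "inv\<^bsub>F\<^esub> a \<otimes>\<^bsub>F\<^esub> k"
    have "(\<Sum>u\<in>B. comult H x (u, (h \<triangleleft> a, ?c)) * (T u (h, a) * \<sigma> h a ?c)) =
      (\<Sum>u\<in>carrier G. \<Sum>p\<in>carrier F. if p = (h \<triangleleft> a) \<triangleright> ?c
        then \<tau> u (h \<triangleleft> a) ?c * x (u \<otimes>\<^bsub>G\<^esub> (h \<triangleleft> a), ?c) * T (u, p) (h, a) * \<sigma> h a ?c else 0)"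
      unfolding sum.cartesian_product'[of _ "carrier G" "carrier F"]
      by (intro sum.cong refl) (auto simp: comult_apply)
    then show "(\<Sum>u\<in>B. comult H x (u, (h \<triangleleft> a, ?c)) * (T u (h, a) * \<sigma> h a ?c)) =
      (\<Sum>u\<in>carrier G. \<tau> u (h \<triangleleft> a) ?c * x (u \<otimes>\<^bsub>G\<^esub> (h \<triangleleft> a), ?c) *
        T (u, (h \<triangleleft> a) \<triangleright> ?c) (h, a) * \<sigma> h a ?c)"
      by (simp add: finite_F)
  qed
  finally show ?thesis .
qed

lemma convolution_closed: "lin_ext (B \<times> B) (\<lambda>(u, v). T u \<bullet>\<^bsub>H\<^esub> T' v) w \<in> vecs B"
  unfolding vecs_def lin_ext_apply
  by (auto intro!: sum.neutral simp: vecs_zero_outside[OF mult_closed])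

lemma S_closed: "S x \<in> vecs B"
  by (auto simp: vecs_def S_def)

lemma S_left:
  "lin_ext (B \<times> B) (\<lambda>(u, v). S (bvec u) \<bullet>\<^bsub>H\<^esub> bvec v) (comult H x) = counit H x *\<^sub>C hunit H"
proof (rule vecs_B_eqI)
  fix h k assume hk [simp]: "h \<in> carrier G" "k \<in> carrier F"
  have inner: "(\<Sum>u\<in>carrier G. \<tau> u (h \<triangleleft> a) (inv\<^bsub>F\<^esub> a \<otimes>\<^bsub>F\<^esub> k) *
      x (u \<otimes>\<^bsub>G\<^esub> (h \<triangleleft> a), inv\<^bsub>F\<^esub> a \<otimes>\<^bsub>F\<^esub> k) *
      S (bvec (u, (h \<triangleleft> a) \<triangleright> (inv\<^bsub>F\<^esub> a \<otimes>\<^bsub>F\<^esub> k))) (h, a) * \<sigma> h a (inv\<^bsub>F\<^esub> a \<otimes>\<^bsub>F\<^esub> k)) =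
    (if k = \<one>\<^bsub>F\<^esub> then x (\<one>\<^bsub>G\<^esub>, inv\<^bsub>F\<^esub> a) else 0)" (is "sum ?t _ = ?r")
    if a [simp]: "a \<in> carrier F" for a
  proof -
    have iff: "inv\<^bsub>F\<^esub> (h \<triangleright> a) = (h \<triangleleft> a) \<triangleright> (inv\<^bsub>F\<^esub> a \<otimes>\<^bsub>F\<^esub> k) \<longleftrightarrow> k = \<one>\<^bsub>F\<^esub>"
      using ra_divides_iff[of h a k "\<one>\<^bsub>F\<^esub>"] ra_eq_one[of h k] by (auto simp: eq_commute)
    have "sum ?t (carrier G) = (\<Sum>u\<in>carrier G. if u = inv\<^bsub>G\<^esub> (h \<triangleleft> a) then ?r else 0)"
      by (rule sum.cong[OF refl]) (auto simp: S_def bvec_apply iff sigma_nonzero tau_nonzero)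
    then show ?thesis using finite_G by simp
  qed
  have "(\<Sum>a\<in>carrier F. x (\<one>\<^bsub>G\<^esub>, inv\<^bsub>F\<^esub> a)) = counit H x"
    unfolding counit_H
    by (rule sum.reindex_bij_witness[where i="\<lambda>a. inv\<^bsub>F\<^esub> a" and j="\<lambda>a. inv\<^bsub>F\<^esub> a"]) auto
  then show "lin_ext (B \<times> B) (\<lambda>(u, v). S (bvec u) \<bullet>\<^bsub>H\<^esub> bvec v) (comult H x) (h, k) =
      (counit H x *\<^sub>C hunit H) (h, k)"
    by (simp add: left_convolution[where T="\<lambda>u. S (bvec u)"] inner sum_if_const unit_apply)
qed (use convolution_closed unit_closed in \<open>auto simp: vecs_def\<close>)

lemma S_right:
  "lin_ext (B \<times> B) (\<lambda>(u, v). bvec u \<bullet>\<^bsub>H\<^esub> S (bvec v)) (comult H x) = counit H x *\<^sub>C hunit H"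
proof (rule vecs_B_eqI)
  fix g f assume gf [simp]: "g \<in> carrier G" "f \<in> carrier F"
  define b where "b = (\<lambda>a. inv\<^bsub>F\<^esub> a \<otimes>\<^bsub>F\<^esub> f)"
  define d where "d = (\<lambda>a. \<sigma> (g \<triangleleft> a) (b a) (inv\<^bsub>F\<^esub> (b a)) *
    \<tau> (inv\<^bsub>G\<^esub> (g \<triangleleft> f)) (g \<triangleleft> f) (inv\<^bsub>F\<^esub> (b a)))"
  define v0 where "v0 = (\<lambda>a. (inv\<^bsub>G\<^esub> (g \<triangleleft> f), inv\<^bsub>F\<^esub> ((g \<triangleleft> a) \<triangleright> b a)))"
  have b [simp]: "b a \<in> carrier F" "g \<triangleleft> a \<triangleleft> b a = g \<triangleleft> f" if "a \<in> carrier F" for a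
    using that by (simp_all add: b_def flip: la_mult)
  have "lin_ext (B \<times> B) (\<lambda>(u, v). bvec u \<bullet>\<^bsub>H\<^esub> S (bvec v)) (comult H x) (g, f) =
    (\<Sum>v\<in>B. \<Sum>u\<in>B. \<Sum>a\<in>carrier F. comult H x (u, v) *
      (S (bvec v) (g \<triangleleft> a, b a) * \<sigma> g a (b a) * bvec u (g, a)))"
    unfolding lin_ext_apply sum.cartesian_product'[of _ B B]
    by (subst sum.swap) (simp add: mult_apply sum_distrib_left mult_ac b_def)
  also have "\<dots> = (\<Sum>v\<in>B. \<Sum>a\<in>carrier F. \<Sum>u\<in>B. comult H x (u, v) *
      (S (bvec v) (g \<triangleleft> a, b a) * \<sigma> g a (b a) * bvec u (g, a)))"
    by (rule sum.cong[OF refl]) (rule sum.swap)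
  also have "\<dots> = (\<Sum>v\<in>B. \<Sum>a\<in>carrier F. comult H x ((g, a), v) * (S (bvec v) (g \<triangleleft> a, b a) * \<sigma> g a (b a)))"
    using finite_B by (intro sum.cong refl sum_bvec_mult) auto
  also have "\<dots> = (\<Sum>a\<in>carrier F. \<Sum>v\<in>B. comult H x ((g, a), v) * (S (bvec v) (g \<triangleleft> a, b a) * \<sigma> g a (b a)))"
    by (rule sum.swap)
  also have "\<dots> = (\<Sum>a\<in>carrier F. comult H x ((g, a), v0 a) * (\<sigma> g a (b a) / d a))"
  proof (rule sum.cong[OF refl])
    fix a assume [simp]: "a \<in> carrier F"
    have v0: "v0 a \<in> B" by (simp add: v0_def)
    have "S (bvec v) (g \<triangleleft> a, b a) = bvec v (v0 a) / d a" for v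
      by (simp add: S_def v0_def d_def)
    then show "(\<Sum>v\<in>B. comult H x ((g, a), v) * (S (bvec v) (g \<triangleleft> a, b a) * \<sigma> g a (b a))) =
      comult H x ((g, a), v0 a) * (\<sigma> g a (b a) / d a)"
      using sum_bvec_mult[OF finite_B v0, of "\<lambda>v. comult H x ((g, a), v)" "\<lambda>v. \<sigma> g a (b a) / d a"]
      by (simp add: mult_ac)
  qed
  also have "\<dots> = (\<Sum>a\<in>carrier F. if f = \<one>\<^bsub>F\<^esub> then x (\<one>\<^bsub>G\<^esub>, g \<triangleright> a) else 0)"
  proof (rule sum.cong[OF refl])
    fix a assume [simp]: "a \<in> carrier F"
    have inv_b: "inv\<^bsub>F\<^esub> (b a) = inv\<^bsub>F\<^esub> f \<otimes>\<^bsub>F\<^esub> a"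
      by (simp add: b_def F.inv_mult_group)
    have "inv\<^bsub>G\<^esub> (g \<triangleleft> f) \<triangleright> inv\<^bsub>F\<^esub> ((g \<triangleleft> a) \<triangleright> b a) = inv\<^bsub>F\<^esub> f \<otimes>\<^bsub>F\<^esub> a"
      by (simp add: inv_ra inv_b)
    moreover have "a = inv\<^bsub>F\<^esub> f \<otimes>\<^bsub>F\<^esub> a \<longleftrightarrow> f = \<one>\<^bsub>F\<^esub>"
      using F.l_cancel_one'[of a "inv\<^bsub>F\<^esub> f"] by simp
    ultimately show "comult H x ((g, a), v0 a) * (\<sigma> g a (b a) / d a) =
      (if f = \<one>\<^bsub>F\<^esub> then x (\<one>\<^bsub>G\<^esub>, g \<triangleright> a) else 0)"
      using sigma_inv[of g a] tau_inv[of g a] sigma_nonzero[of g a "inv\<^bsub>F\<^esub> a"] tau_nonzero[of "inv\<^bsub>G\<^esub> g" g a]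
        inv_ra[of "g \<triangleleft> a" "inv\<^bsub>F\<^esub> a"]
      by (auto simp: comult_apply v0_def d_def b_def)
  qed
  also have "\<dots> = (if f = \<one>\<^bsub>F\<^esub> then counit H x else 0)"
  proof -
    have "(\<Sum>a\<in>carrier F. x (\<one>\<^bsub>G\<^esub>, g \<triangleright> a)) = counit H x"
      unfolding counit_H
      by (rule sum.reindex_bij_witness[where i="\<lambda>a. inv\<^bsub>G\<^esub> g \<triangleright> a" and j="\<lambda>a. g \<triangleright> a"]) auto
    then show ?thesis by simp
  qed
  finally show "lin_ext (B \<times> B) (\<lambda>(u, v). bvec u \<bullet>\<^bsub>H\<^esub> S (bvec v)) (comult H x) (g, f) =
      (counit H x *\<^sub>C hunit H) (g, f)"
    by (simp add: unit_apply)
qed (use convolution_closed unit_closed in \<open>auto simp: vecs_def\<close>)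

lemma is_antipode_S: "is_antipode H S"
  unfolding is_antipode_def linear_on_def hbasis_H
  by (simp add: S_closed S_left S_right) (auto simp: S_def algebra_simps add_divide_distrib intro!: ext)

lemma hopf_algebra_H: "hopf_algebra H"
  using bialgebra_H is_antipode_S by (auto simp: hopf_algebra_def)

text \<open>
  The coproduct of \<open>e\<^bsub>b (h \<triangleleft> a)\<^esub> # f\<close> contains the term with first leg \<open>e\<^sub>b # p\<close> and second leg
  \<open>e\<^bsub>h \<triangleleft> a\<^esub> # f\<close>.  It is the only one that contributes to the coefficient of the left antipode
  equation at \<open>(h, a f)\<close>, so the equation yields each matrix coefficient of \<open>T\<close> up to a known nonzero factor.
\<close>

lemma antipode_coefficient:
  assumes T: "is_antipode H T"
    and [simp]: "b \<in> carrier G" "p \<in> carrier F" "h \<in> carrier G" "a \<in> carrier F"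
  defines "f \<equiv> inv\<^bsub>G\<^esub> (h \<triangleleft> a) \<triangleright> p"
  shows "\<tau> b (h \<triangleleft> a) f * T (bvec (b, p)) (h, a) * \<sigma> h a f =
    counit H (bvec (b \<otimes>\<^bsub>G\<^esub> (h \<triangleleft> a), f)) * hunit H (h, a \<otimes>\<^bsub>F\<^esub> f)"
proof -
  have [simp]: "f \<in> carrier F" by (simp add: f_def)
  let ?e = "bvec (b \<otimes>\<^bsub>G\<^esub> (h \<triangleleft> a), f)"
  have e: "?e \<in> vecs B" by (rule bvec_in_vecs) simp
  have "(\<Sum>u\<in>carrier G. \<tau> u (h \<triangleleft> a') (inv\<^bsub>F\<^esub> a' \<otimes>\<^bsub>F\<^esub> (a \<otimes>\<^bsub>F\<^esub> f)) *
      ?e (u \<otimes>\<^bsub>G\<^esub> (h \<triangleleft> a'), inv\<^bsub>F\<^esub> a' \<otimes>\<^bsub>F\<^esub> (a \<otimes>\<^bsub>F\<^esub> f)) *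
      T (bvec (u, (h \<triangleleft> a') \<triangleright> (inv\<^bsub>F\<^esub> a' \<otimes>\<^bsub>F\<^esub> (a \<otimes>\<^bsub>F\<^esub> f)))) (h, a') *
      \<sigma> h a' (inv\<^bsub>F\<^esub> a' \<otimes>\<^bsub>F\<^esub> (a \<otimes>\<^bsub>F\<^esub> f))) =
    (if a' = a then \<tau> b (h \<triangleleft> a) f * T (bvec (b, p)) (h, a) * \<sigma> h a f else 0)" (is "sum ?t _ = ?r")
    if [simp]: "a' \<in> carrier F" for a'
  proof (cases "a' = a")
    case [simp]: True
    have "sum ?t (carrier G) = (\<Sum>u\<in>carrier G. if u = b then ?r else 0)"
      by (rule sum.cong[OF refl]) (auto simp: bvec_apply, simp_all add: f_def)
    then show ?thesis using finite_G by simp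
  next
    case False
    have "inv\<^bsub>F\<^esub> a' \<otimes>\<^bsub>F\<^esub> (a \<otimes>\<^bsub>F\<^esub> f) \<noteq> f"
    proof
      assume "inv\<^bsub>F\<^esub> a' \<otimes>\<^bsub>F\<^esub> (a \<otimes>\<^bsub>F\<^esub> f) = f"
      then have "a \<otimes>\<^bsub>F\<^esub> f = a' \<otimes>\<^bsub>F\<^esub> f"
        using F_cancel(1)[of a' "a \<otimes>\<^bsub>F\<^esub> f"] by simp
      then show False using False by simp
    qed
    then show ?thesis using False by (simp add: bvec_apply)
  qed
  moreover have "lin_ext (B \<times> B) (\<lambda>(u, v). T (bvec u) \<bullet>\<^bsub>H\<^esub> bvec v) (comult H ?e) (h, a \<otimes>\<^bsub>F\<^esub> f) =
      (counit H ?e *\<^sub>C hunit H) (h, a \<otimes>\<^bsub>F\<^esub> f)"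
    using T e by (simp add: is_antipode_def)
  ultimately show ?thesis
    using finite_F by (simp add: left_convolution[where T="\<lambda>u. T (bvec u)"])
qed

text \<open>
  The equations of \<open>antipode_coefficient\<close> for two antipodes have the same right-hand side, so all antipodes agree
  with \<open>S\<close> on the basis.
\<close>

lemma antipode_bvec:
  assumes "b \<in> B" shows "antipode H (bvec b) = S (bvec b)"
proof (rule vecs_B_eqI[OF _ S_closed])
  have A: "is_antipode H (antipode H)"
    unfolding antipode_def by (rule someI[of _ S]) (rule is_antipode_S)
  then show "antipode H (bvec b) \<in> vecs B"
    using bvec_in_vecs[OF assms] by (simp add: is_antipode_def)
  fix h a assume ha: "h \<in> carrier G" "a \<in> carrier F"
  obtain g p where b: "b = (g, p)" "g \<in> carrier G" "p \<in> carrier F" using assms by auto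
  show "antipode H (bvec b) (h, a) = S (bvec b) (h, a)"
    using trans[OF antipode_coefficient[OF A b(2,3) ha]
        antipode_coefficient[OF is_antipode_S b(2,3) ha, symmetric]] b ha
    by (simp add: tau_nonzero sigma_nonzero)
qed

section \<open>The involution\<close>

abbreviation star where "star \<alpha> \<equiv> bicrossed_star F G (\<triangleleft>) \<alpha>"

lemma star_apply:
  "star \<alpha> x (g, f) =
    (if g \<in> carrier G \<and> f \<in> carrier F then \<alpha> f g * cnj (x (g \<triangleleft> f, inv\<^bsub>F\<^esub> f)) else 0)"
proof -
  have "star \<alpha> x (g, f) = (\<Sum>b\<in>B. if b = (g \<triangleleft> f, inv\<^bsub>F\<^esub> f) \<and> g \<in> carrier G \<and> f \<in> carrier F
      then \<alpha> f g * cnj (x b) else 0)"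
    unfolding bicrossed_star_def conj_lin_ext_apply
    by (rule sum.cong) (auto simp: bvec_apply split: if_splits)
  then show ?thesis using finite_B by (auto simp: sum_if_const)
qed

lemma star_closed: "star \<alpha> x \<in> vecs B"
  by (auto simp: vecs_def star_apply)

lemma star_add: "star \<alpha> (x + y) = star \<alpha> x + star \<alpha> y"
  and star_scale: "star \<alpha> (c *\<^sub>C x) = cnj c *\<^sub>C star \<alpha> x"
  by (auto simp: star_apply algebra_simps intro!: ext)

lemma star_star_apply:
  "\<lbrakk>g \<in> carrier G; f \<in> carrier F\<rbrakk> \<Longrightarrow>
    star \<alpha> (star \<alpha> x) (g, f) = \<alpha> f g * cnj (\<alpha> (inv\<^bsub>F\<^esub> f) (g \<triangleleft> f)) * x (g, f)"
  by (simp add: star_apply)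

lemma involutive_iff:
  "(\<forall>x\<in>vecs B. star \<alpha> (star \<alpha> x) = x) \<longleftrightarrow>
   (\<forall>g\<in>carrier G. \<forall>f\<in>carrier F. \<alpha> f g * cnj (\<alpha> (inv\<^bsub>F\<^esub> f) (g \<triangleleft> f)) = 1)" (is "?L \<longleftrightarrow> ?R")
proof
  assume L: ?L
  show ?R
  proof (intro ballI)
    fix g f assume gf: "g \<in> carrier G" "f \<in> carrier F"
    then have "star \<alpha> (star \<alpha> (bvec (g, f))) (g, f) = bvec (g, f) (g, f)"
      using L bvec_in_vecs[of "(g, f)" B] by simp
    then show "\<alpha> f g * cnj (\<alpha> (inv\<^bsub>F\<^esub> f) (g \<triangleleft> f)) = 1"
      using gf by (simp add: star_star_apply bvec_apply)
  qed
next
  assume ?R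
  then show ?L by (auto intro!: vecs_B_eqI star_closed simp: star_star_apply)
qed

text \<open>
  Substituting \<open>c = f\<inverse> a\<close> in the convolution brings \<open>(x y)\<^sup>*\<close> and \<open>y\<^sup>* x\<^sup>*\<close> into sums over \<open>a\<close> with the same products
  of coordinates of \<open>x\<close> and \<open>y\<close>; they differ only in the scalar factors.
\<close>

lemma star_mult_apply:
  assumes [simp]: "g \<in> carrier G" "f \<in> carrier F"
  shows "star \<alpha> (x \<bullet>\<^bsub>H\<^esub> y) (g, f) =
    (\<Sum>a\<in>carrier F. cnj (x (g \<triangleleft> f, inv\<^bsub>F\<^esub> f \<otimes>\<^bsub>F\<^esub> a)) * cnj (y (g \<triangleleft> a, inv\<^bsub>F\<^esub> a)) *
      (\<alpha> f g * cnj (\<sigma> (g \<triangleleft> f) (inv\<^bsub>F\<^esub> f \<otimes>\<^bsub>F\<^esub> a) (inv\<^bsub>F\<^esub> a))))"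
proof -
  have "star \<alpha> (x \<bullet>\<^bsub>H\<^esub> y) (g, f) = (\<Sum>c\<in>carrier F. cnj (x (g \<triangleleft> f, c)) *
      cnj (y (g \<triangleleft> f \<triangleleft> c, inv\<^bsub>F\<^esub> c \<otimes>\<^bsub>F\<^esub> inv\<^bsub>F\<^esub> f)) *
      (\<alpha> f g * cnj (\<sigma> (g \<triangleleft> f) c (inv\<^bsub>F\<^esub> c \<otimes>\<^bsub>F\<^esub> inv\<^bsub>F\<^esub> f))))" (is "_ = sum ?t _")
    by (simp add: star_apply mult_apply sum_distrib_left mult_ac)
  also have "\<dots> = (\<Sum>a\<in>carrier F. ?t (inv\<^bsub>F\<^esub> f \<otimes>\<^bsub>F\<^esub> a))"
    by (rule sum_F_shift[symmetric]) simp
  finally show ?thesis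
    by (simp add: la_mult F.inv_mult_group F.m_assoc)
qed

lemma mult_star_apply:
  assumes [simp]: "g \<in> carrier G" "f \<in> carrier F"
  shows "(star \<alpha> y \<bullet>\<^bsub>H\<^esub> star \<alpha> x) (g, f) =
    (\<Sum>a\<in>carrier F. cnj (x (g \<triangleleft> f, inv\<^bsub>F\<^esub> f \<otimes>\<^bsub>F\<^esub> a)) * cnj (y (g \<triangleleft> a, inv\<^bsub>F\<^esub> a)) *
      (\<alpha> a g * \<alpha> (inv\<^bsub>F\<^esub> a \<otimes>\<^bsub>F\<^esub> f) (g \<triangleleft> a) * \<sigma> g a (inv\<^bsub>F\<^esub> a \<otimes>\<^bsub>F\<^esub> f)))"
  by (simp add: star_apply mult_apply mult_ac F.inv_mult_group flip: la_mult)

lemma antimultiplicative_iff: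
  "(\<forall>x\<in>vecs B. \<forall>y\<in>vecs B. star \<alpha> (x \<bullet>\<^bsub>H\<^esub> y) = star \<alpha> y \<bullet>\<^bsub>H\<^esub> star \<alpha> x) \<longleftrightarrow>
   (\<forall>g\<in>carrier G. \<forall>f\<^sub>1\<in>carrier F. \<forall>f\<^sub>2\<in>carrier F.
      \<alpha> f\<^sub>1 g * \<alpha> f\<^sub>2 (g \<triangleleft> f\<^sub>1) * \<sigma> g f\<^sub>1 f\<^sub>2 =
      \<alpha> (f\<^sub>1 \<otimes>\<^bsub>F\<^esub> f\<^sub>2) g * cnj (\<sigma> (g \<triangleleft> (f\<^sub>1 \<otimes>\<^bsub>F\<^esub> f\<^sub>2)) (inv\<^bsub>F\<^esub> f\<^sub>2) (inv\<^bsub>F\<^esub> f\<^sub>1)))"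
  (is "?L \<longleftrightarrow> ?R")
proof
  assume L: ?L
  show ?R
  proof (intro ballI)
    fix g f\<^sub>1 f\<^sub>2 assume [simp]: "g \<in> carrier G" "f\<^sub>1 \<in> carrier F" "f\<^sub>2 \<in> carrier F"
    \<comment> \<open>Up to scalars these are \<open>(e\<^bsub>g \<triangleleft> f\<^sub>1\<^esub> # f\<^sub>2)\<^sup>*\<close> and \<open>(e\<^sub>g # f\<^sub>1)\<^sup>*\<close>, so only \<open>a = f\<^sub>1\<close> survives.\<close>
    let ?x = "bvec (g \<triangleleft> (f\<^sub>1 \<otimes>\<^bsub>F\<^esub> f\<^sub>2), inv\<^bsub>F\<^esub> f\<^sub>2)" and ?y = "bvec (g \<triangleleft> f\<^sub>1, inv\<^bsub>F\<^esub> f\<^sub>1)"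
    have eq: "cnj (?x (g \<triangleleft> (f\<^sub>1 \<otimes>\<^bsub>F\<^esub> f\<^sub>2), inv\<^bsub>F\<^esub> (f\<^sub>1 \<otimes>\<^bsub>F\<^esub> f\<^sub>2) \<otimes>\<^bsub>F\<^esub> a)) * cnj (?y (g \<triangleleft> a, inv\<^bsub>F\<^esub> a)) * c =
      (if a = f\<^sub>1 then c else 0)" if [simp]: "a \<in> carrier F" for a c
    proof -
      have "inv\<^bsub>F\<^esub> a = inv\<^bsub>F\<^esub> f\<^sub>1 \<longleftrightarrow> a = f\<^sub>1"
        by (metis F.inv_inv \<open>f\<^sub>1 \<in> carrier F\<close> that)
      then show ?thesis by (auto simp: bvec_apply F.inv_mult_group F.m_assoc)
    qed
    have "star \<alpha> (?x \<bullet>\<^bsub>H\<^esub> ?y) (g, f\<^sub>1 \<otimes>\<^bsub>F\<^esub> f\<^sub>2) = (star \<alpha> ?y \<bullet>\<^bsub>H\<^esub> star \<alpha> ?x) (g, f\<^sub>1 \<otimes>\<^bsub>F\<^esub> f\<^sub>2)"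
      using L by (simp add: bvec_in_vecs)
    then show "\<alpha> f\<^sub>1 g * \<alpha> f\<^sub>2 (g \<triangleleft> f\<^sub>1) * \<sigma> g f\<^sub>1 f\<^sub>2 =
      \<alpha> (f\<^sub>1 \<otimes>\<^bsub>F\<^esub> f\<^sub>2) g * cnj (\<sigma> (g \<triangleleft> (f\<^sub>1 \<otimes>\<^bsub>F\<^esub> f\<^sub>2)) (inv\<^bsub>F\<^esub> f\<^sub>2) (inv\<^bsub>F\<^esub> f\<^sub>1))"
      by (simp add: star_mult_apply mult_star_apply eq finite_F)
        (simp add: F.inv_mult_group F.m_assoc)
  qed
next
  assume R: ?R
  have "star \<alpha> (x \<bullet>\<^bsub>H\<^esub> y) = star \<alpha> y \<bullet>\<^bsub>H\<^esub> star \<alpha> x" for x y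
  proof (rule vecs_B_eqI[OF star_closed mult_closed])
    fix g f assume [simp]: "g \<in> carrier G" "f \<in> carrier F"
    have "\<alpha> f g * cnj (\<sigma> (g \<triangleleft> f) (inv\<^bsub>F\<^esub> f \<otimes>\<^bsub>F\<^esub> a) (inv\<^bsub>F\<^esub> a)) =
      \<alpha> a g * \<alpha> (inv\<^bsub>F\<^esub> a \<otimes>\<^bsub>F\<^esub> f) (g \<triangleleft> a) * \<sigma> g a (inv\<^bsub>F\<^esub> a \<otimes>\<^bsub>F\<^esub> f)"
      if [simp]: "a \<in> carrier F" for a
      using R[rule_format, of g a "inv\<^bsub>F\<^esub> a \<otimes>\<^bsub>F\<^esub> f"] by (simp add: F.inv_mult_group)
    then show "star \<alpha> (x \<bullet>\<^bsub>H\<^esub> y) (g, f) = (star \<alpha> y \<bullet>\<^bsub>H\<^esub> star \<alpha> x) (g, f)"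
      by (simp add: star_mult_apply mult_star_apply)
  qed
  then show ?L by blast
qed

lemma star_comult_apply:
  assumes B: "(g\<^sub>1, p) \<in> B" "(g\<^sub>2, f) \<in> B"
  shows "conj_lin_ext (B \<times> B) (\<lambda>(u, v). star \<alpha> (bvec u) \<boxtimes> star \<alpha> (bvec v)) w ((g\<^sub>1, p), (g\<^sub>2, f)) =
    \<alpha> p g\<^sub>1 * \<alpha> f g\<^sub>2 * cnj (w ((g\<^sub>1 \<triangleleft> p, inv\<^bsub>F\<^esub> p), (g\<^sub>2 \<triangleleft> f, inv\<^bsub>F\<^esub> f)))"
proof -
  let ?p = "(g\<^sub>1 \<triangleleft> p, inv\<^bsub>F\<^esub> p)" and ?q = "(g\<^sub>2 \<triangleleft> f, inv\<^bsub>F\<^esub> f)"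
  have pq: "(?p, ?q) \<in> B \<times> B" using B by simp
  have "conj_lin_ext (B \<times> B) (\<lambda>(u, v). star \<alpha> (bvec u) \<boxtimes> star \<alpha> (bvec v)) w ((g\<^sub>1, p), (g\<^sub>2, f)) =
    (\<Sum>r\<in>B \<times> B. if r = (?p, ?q) then \<alpha> p g\<^sub>1 * \<alpha> f g\<^sub>2 * cnj (w (?p, ?q)) else 0)"
    unfolding conj_lin_ext_apply using B
    by (intro sum.cong refl) (auto simp: star_apply bvec_apply split: if_splits)
  then show ?thesis using pq finite_B by (simp del: mem_Sigma_iff)
qed

lemma star_comult_closed:
  "conj_lin_ext (B \<times> B) (\<lambda>(u, v). star \<alpha> (bvec u) \<boxtimes> star \<alpha> (bvec v)) w \<in> vecs (B \<times> B)"
  unfolding vecs_def conj_lin_ext_apply by (auto simp: star_apply intro!: sum.neutral split: if_splits)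

lemma inv_F_eq_iff: "a \<in> carrier F \<Longrightarrow> b \<in> carrier F \<Longrightarrow> inv\<^bsub>F\<^esub> a = inv\<^bsub>F\<^esub> b \<longleftrightarrow> a = b"
  by (metis F.inv_inv)

text \<open>
  Both sides are supported on \<open>p = g\<^sub>2 \<triangleright> f\<close> and involve the same coordinate of \<open>x\<close>, because
  \<open>(g\<^sub>1 g\<^sub>2) \<triangleleft> f = (g\<^sub>1 \<triangleleft> (g\<^sub>2 \<triangleright> f)) (g\<^sub>2 \<triangleleft> f)\<close>.
\<close>

lemma comultiplicative_iff:
  "(\<forall>x\<in>vecs B. comult H (star \<alpha> x) =
      conj_lin_ext (B \<times> B) (\<lambda>(u, v). star \<alpha> (bvec u) \<boxtimes> star \<alpha> (bvec v)) (comult H x)) \<longleftrightarrow>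
   (\<forall>g\<^sub>1\<in>carrier G. \<forall>g\<^sub>2\<in>carrier G. \<forall>f\<in>carrier F.
      \<alpha> f (g\<^sub>1 \<otimes>\<^bsub>G\<^esub> g\<^sub>2) * \<tau> g\<^sub>1 g\<^sub>2 f =
      \<alpha> (g\<^sub>2 \<triangleright> f) g\<^sub>1 * \<alpha> f g\<^sub>2 * cnj (\<tau> (g\<^sub>1 \<triangleleft> (g\<^sub>2 \<triangleright> f)) (g\<^sub>2 \<triangleleft> f) (inv\<^bsub>F\<^esub> f)))"
  (is "?L \<longleftrightarrow> ?R")
proof -
  let ?C = "\<lambda>x. conj_lin_ext (B \<times> B) (\<lambda>(u, v). star \<alpha> (bvec u) \<boxtimes> star \<alpha> (bvec v)) (comult H x)"
  have left: "comult H (star \<alpha> x) ((g\<^sub>1, p), (g\<^sub>2, f)) =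
      (if p = g\<^sub>2 \<triangleright> f then \<alpha> f (g\<^sub>1 \<otimes>\<^bsub>G\<^esub> g\<^sub>2) * \<tau> g\<^sub>1 g\<^sub>2 f * cnj (x ((g\<^sub>1 \<otimes>\<^bsub>G\<^esub> g\<^sub>2) \<triangleleft> f, inv\<^bsub>F\<^esub> f)) else 0)"
    and right: "?C x ((g\<^sub>1, p), (g\<^sub>2, f)) =
      (if p = g\<^sub>2 \<triangleright> f then \<alpha> (g\<^sub>2 \<triangleright> f) g\<^sub>1 * \<alpha> f g\<^sub>2 *
        cnj (\<tau> (g\<^sub>1 \<triangleleft> (g\<^sub>2 \<triangleright> f)) (g\<^sub>2 \<triangleleft> f) (inv\<^bsub>F\<^esub> f)) * cnj (x ((g\<^sub>1 \<otimes>\<^bsub>G\<^esub> g\<^sub>2) \<triangleleft> f, inv\<^bsub>F\<^esub> f)) else 0)"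
    if "(g\<^sub>1, p) \<in> B" "(g\<^sub>2, f) \<in> B" for x g\<^sub>1 p g\<^sub>2 f
    using that by (auto simp: comult_apply star_apply star_comult_apply la_distrib inv_F_eq_iff
        simp flip: inv_ra)
  show ?thesis
  proof
    assume L: ?L
    show ?R
    proof (intro ballI)
      fix g\<^sub>1 g\<^sub>2 f assume [simp]: "g\<^sub>1 \<in> carrier G" "g\<^sub>2 \<in> carrier G" "f \<in> carrier F"
      let ?x = "bvec ((g\<^sub>1 \<otimes>\<^bsub>G\<^esub> g\<^sub>2) \<triangleleft> f, inv\<^bsub>F\<^esub> f)"
      have "comult H (star \<alpha> ?x) ((g\<^sub>1, g\<^sub>2 \<triangleright> f), (g\<^sub>2, f)) = ?C ?x ((g\<^sub>1, g\<^sub>2 \<triangleright> f), (g\<^sub>2, f))"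
        using L by (simp add: bvec_in_vecs)
      then show "\<alpha> f (g\<^sub>1 \<otimes>\<^bsub>G\<^esub> g\<^sub>2) * \<tau> g\<^sub>1 g\<^sub>2 f =
          \<alpha> (g\<^sub>2 \<triangleright> f) g\<^sub>1 * \<alpha> f g\<^sub>2 * cnj (\<tau> (g\<^sub>1 \<triangleleft> (g\<^sub>2 \<triangleright> f)) (g\<^sub>2 \<triangleleft> f) (inv\<^bsub>F\<^esub> f))"
        by (simp add: left right bvec_apply)
    qed
  next
    assume R: ?R
    have "comult H (star \<alpha> x) i = ?C x i" for x i
    proof (cases "i \<in> B \<times> B")
      case True
      then show ?thesis using R by (auto simp: left right)
    next
      case False
      then show ?thesis
        using vecs_zero_outside[OF comult_closed] vecs_zero_outside[OF star_comult_closed] by metis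
    qed
    then show ?L by blast
  qed
qed

theorem star_hopf_algebra_iff:
  "star_hopf_algebra H (star \<alpha>) \<longleftrightarrow> star_conditions F G (\<triangleleft>) (\<triangleright>) \<sigma> \<tau> \<alpha>"
proof -
  have nonzero: "\<alpha> f g \<noteq> 0"
    if inv: "\<forall>g\<in>carrier G. \<forall>f\<in>carrier F. \<alpha> f g * cnj (\<alpha> (inv\<^bsub>F\<^esub> f) (g \<triangleleft> f)) = 1"
    and "g \<in> carrier G" "f \<in> carrier F" for g f
    using inv[rule_format, OF that(2,3)] by auto
  \<comment> \<open>At unit arguments the other conditions turn \<open>\<alpha> 1 g\<close> and \<open>\<alpha> f 1\<close> into nonzero idempotents.\<close>
  have norm: "(\<forall>g\<in>carrier G. \<alpha> \<one>\<^bsub>F\<^esub> g = 1) \<and> (\<forall>f\<in>carrier F. \<alpha> f \<one>\<^bsub>G\<^esub> = 1)"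
    if inv: "\<forall>g\<in>carrier G. \<forall>f\<in>carrier F. \<alpha> f g * cnj (\<alpha> (inv\<^bsub>F\<^esub> f) (g \<triangleleft> f)) = 1"
    and mul: "\<forall>g\<in>carrier G. \<forall>f\<^sub>1\<in>carrier F. \<forall>f\<^sub>2\<in>carrier F.
      \<alpha> f\<^sub>1 g * \<alpha> f\<^sub>2 (g \<triangleleft> f\<^sub>1) * \<sigma> g f\<^sub>1 f\<^sub>2 =
      \<alpha> (f\<^sub>1 \<otimes>\<^bsub>F\<^esub> f\<^sub>2) g * cnj (\<sigma> (g \<triangleleft> (f\<^sub>1 \<otimes>\<^bsub>F\<^esub> f\<^sub>2)) (inv\<^bsub>F\<^esub> f\<^sub>2) (inv\<^bsub>F\<^esub> f\<^sub>1))"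
    and com: "\<forall>g\<^sub>1\<in>carrier G. \<forall>g\<^sub>2\<in>carrier G. \<forall>f\<in>carrier F.
      \<alpha> f (g\<^sub>1 \<otimes>\<^bsub>G\<^esub> g\<^sub>2) * \<tau> g\<^sub>1 g\<^sub>2 f =
      \<alpha> (g\<^sub>2 \<triangleright> f) g\<^sub>1 * \<alpha> f g\<^sub>2 * cnj (\<tau> (g\<^sub>1 \<triangleleft> (g\<^sub>2 \<triangleright> f)) (g\<^sub>2 \<triangleleft> f) (inv\<^bsub>F\<^esub> f))"
  proof (intro conjI ballI)
    fix g assume "g \<in> carrier G"
    then show "\<alpha> \<one>\<^bsub>F\<^esub> g = 1"
      using mul[rule_format, of g "\<one>\<^bsub>F\<^esub>" "\<one>\<^bsub>F\<^esub>"] nonzero[OF inv, of g "\<one>\<^bsub>F\<^esub>"] by simp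
  next
    fix f assume "f \<in> carrier F"
    then show "\<alpha> f \<one>\<^bsub>G\<^esub> = 1"
      using com[rule_format, of "\<one>\<^bsub>G\<^esub>" "\<one>\<^bsub>G\<^esub>" f] nonzero[OF inv, of "\<one>\<^bsub>G\<^esub>" f] by simp
  qed
  have "star_hopf_algebra H (star \<alpha>) \<longleftrightarrow>
    (\<forall>x\<in>vecs B. star \<alpha> (star \<alpha> x) = x) \<and>
    (\<forall>x\<in>vecs B. \<forall>y\<in>vecs B. star \<alpha> (x \<bullet>\<^bsub>H\<^esub> y) = star \<alpha> y \<bullet>\<^bsub>H\<^esub> star \<alpha> x) \<and>
    (\<forall>x\<in>vecs B. comult H (star \<alpha> x) =
      conj_lin_ext (B \<times> B) (\<lambda>(u, v). star \<alpha> (bvec u) \<boxtimes> star \<alpha> (bvec v)) (comult H x))"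
    by (simp add: star_hopf_algebra_def hopf_algebra_H star_closed conj_linear_on_def linear_on_def
        star_add star_scale)
  then show ?thesis
    unfolding involutive_iff antimultiplicative_iff comultiplicative_iff star_conditions_def
    using norm by blast
qed

section \<open>Compactness\<close>

text \<open>
  The diagonal entry \<open>h((e\<^sub>g # f)\<^sup>* (e\<^sub>g # f))\<close> for the Haar functional \<open>h(e\<^sub>g # f) = \<delta>\<^sub>f\<^sub>,\<^sub>1\<close>, rewritten with
  \<open>sigma_inv\<close>.
\<close>

definition weight :: "('f \<Rightarrow> 'g \<Rightarrow> complex) \<Rightarrow> 'g \<Rightarrow> 'f \<Rightarrow> complex" where
  "weight \<alpha> g f = \<alpha> (inv\<^bsub>F\<^esub> f) (g \<triangleleft> f) * \<sigma> g f (inv\<^bsub>F\<^esub> f)"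

text \<open>
  The product of the condition on \<open>\<alpha>\<close> and \<open>\<tau>\<close> at \<open>f = q\<inverse>\<close> with the compatibility of \<open>\<sigma>\<close> and \<open>\<tau>\<close> at
  \<open>(q, q\<inverse>)\<close>.  This identity of scalars is what makes the averaged inner product invariant.
\<close>

lemma weight_mult:
  assumes "star_conditions F G (\<triangleleft>) (\<triangleright>) \<sigma> \<tau> \<alpha>"
    and [simp]: "c \<in> carrier G" "k \<in> carrier G" "q \<in> carrier F"
  shows "weight \<alpha> (c \<otimes>\<^bsub>G\<^esub> k) q =
    weight \<alpha> k q * weight \<alpha> c (k \<triangleright> q) * \<tau> c k q * cnj (\<tau> c k q)"
proof -
  let ?g = "c \<triangleleft> (k \<triangleright> q)" and ?h = "k \<triangleleft> q"
  have t: "\<tau> ?g ?h (inv\<^bsub>F\<^esub> q) \<noteq> 0" by (rule tau_nonzero) auto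
  have "\<alpha> (inv\<^bsub>F\<^esub> q) (?g \<otimes>\<^bsub>G\<^esub> ?h) * \<tau> ?g ?h (inv\<^bsub>F\<^esub> q) =
    \<alpha> (inv\<^bsub>F\<^esub> (k \<triangleright> q)) ?g * \<alpha> (inv\<^bsub>F\<^esub> q) ?h * cnj (\<tau> c k q)"
  proof -
    have "\<forall>g\<^sub>1\<in>carrier G. \<forall>g\<^sub>2\<in>carrier G. \<forall>f\<in>carrier F.
      \<alpha> f (g\<^sub>1 \<otimes>\<^bsub>G\<^esub> g\<^sub>2) * \<tau> g\<^sub>1 g\<^sub>2 f =
      \<alpha> (g\<^sub>2 \<triangleright> f) g\<^sub>1 * \<alpha> f g\<^sub>2 * cnj (\<tau> (g\<^sub>1 \<triangleleft> (g\<^sub>2 \<triangleright> f)) (g\<^sub>2 \<triangleleft> f) (inv\<^bsub>F\<^esub> f))"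
      using assms(1) unfolding star_conditions_def by blast
    from this[rule_format, of ?g ?h "inv\<^bsub>F\<^esub> q"] show ?thesis
      by (simp flip: inv_ra)
  qed
  moreover have "\<sigma> (c \<otimes>\<^bsub>G\<^esub> k) q (inv\<^bsub>F\<^esub> q) =
    \<sigma> c (k \<triangleright> q) (inv\<^bsub>F\<^esub> (k \<triangleright> q)) * \<sigma> k q (inv\<^bsub>F\<^esub> q) * \<tau> c k q * \<tau> ?g ?h (inv\<^bsub>F\<^esub> q)"
    using sigma_tau_compatible[of c k q "inv\<^bsub>F\<^esub> q"] by (simp add: inv_ra)
  ultimately show ?thesis
    using t by (simp add: weight_def la_distrib mult_ac)
qed

text \<open>
  Coordinatewise form of the invariance of an inner product \<open>ip\<close> on a comodule, to be used with
  \<open>P b = ip (\<rho> u b) v\<close> and \<open>Q b = ip u (\<rho> v b)\<close>.  The equation at \<open>(k, q)\<close> compares the coefficients at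
  \<open>(k \<triangleleft> q, q\<inverse>)\<close>.
\<close>

lemma invariance_iff:
  "(\<Sum>b\<in>B. P b *\<^sub>C antipode H (bvec b)) = (\<Sum>b\<in>B. Q b *\<^sub>C star \<alpha> (bvec b)) \<longleftrightarrow>
   (\<forall>k\<in>carrier G. \<forall>q\<in>carrier F.
      P (inv\<^bsub>G\<^esub> k, k \<triangleright> q) = weight \<alpha> k q * \<tau> (inv\<^bsub>G\<^esub> k) k q * Q (k, q))"
  (is "?s = ?t \<longleftrightarrow> ?R")
proof -
  have "?s = (\<Sum>b\<in>B. P b *\<^sub>C S (bvec b))"
    by (intro sum.cong refl) (simp only: antipode_bvec)
  then have s: "?s i = (\<Sum>b\<in>B. P b * S (bvec b) i)" for i
    by (simp add: sum_apply)
  have s1: "?s (k \<triangleleft> q, inv\<^bsub>F\<^esub> q) = P (inv\<^bsub>G\<^esub> k, k \<triangleright> q) / (\<sigma> k q (inv\<^bsub>F\<^esub> q) * \<tau> (inv\<^bsub>G\<^esub> k) k q)"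
    if "k \<in> carrier G" "q \<in> carrier F" for k q
    unfolding s using that
    using sum_bvec[OF finite_B, of "(inv\<^bsub>G\<^esub> k, k \<triangleright> q)" P]
    by (simp add: S_apply flip: sum_divide_distrib)
  have t1: "?t (k \<triangleleft> q, inv\<^bsub>F\<^esub> q) = \<alpha> (inv\<^bsub>F\<^esub> q) (k \<triangleleft> q) * Q (k, q)"
    if "k \<in> carrier G" "q \<in> carrier F" for k q
  proof -
    have "?t (k \<triangleleft> q, inv\<^bsub>F\<^esub> q) = (\<Sum>b\<in>B. (\<alpha> (inv\<^bsub>F\<^esub> q) (k \<triangleleft> q) * Q b) * bvec b (k, q))"
      unfolding sum_apply using that
      by (intro sum.cong refl) (auto simp: star_apply bvec_apply)
    then show ?thesis using that sum_bvec[OF finite_B, of "(k, q)"] by simp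
  qed
  have iff: "?s (k \<triangleleft> q, inv\<^bsub>F\<^esub> q) = ?t (k \<triangleleft> q, inv\<^bsub>F\<^esub> q) \<longleftrightarrow>
      P (inv\<^bsub>G\<^esub> k, k \<triangleright> q) = weight \<alpha> k q * \<tau> (inv\<^bsub>G\<^esub> k) k q * Q (k, q)"
    if "k \<in> carrier G" "q \<in> carrier F" for k q
    unfolding s1[OF that] t1[OF that] using that
    by (auto simp: weight_def field_simps sigma_nonzero tau_nonzero)
  show ?thesis
  proof
    assume ?R
    show "?s = ?t"
    proof (rule vecs_B_eqI)
      show "?s \<in> vecs B" unfolding vecs_def s by (auto simp: S_def)
      show "?t \<in> vecs B" unfolding vecs_def sum_apply by (auto simp: star_apply)
      fix g f assume gf: "g \<in> carrier G" "f \<in> carrier F"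
      then show "?s (g, f) = ?t (g, f)"
        using iff[of "g \<triangleleft> f" "inv\<^bsub>F\<^esub> f"] \<open>?R\<close> by simp
    qed
  qed (use iff in auto)
qed

lemma comodule_coassoc:
  assumes "right_comodule H V \<rho>" "v \<in> V"
    and "(g\<^sub>1, p) \<in> B" "(g\<^sub>2, f) \<in> B"
  shows "\<rho> (\<rho> v (g\<^sub>2, f)) (g\<^sub>1, p) =
    (if p = g\<^sub>2 \<triangleright> f then \<tau> g\<^sub>1 g\<^sub>2 f *\<^sub>C \<rho> v (g\<^sub>1 \<otimes>\<^bsub>G\<^esub> g\<^sub>2, f) else 0)"
proof
  fix i
  have "\<rho> (\<rho> v (g\<^sub>2, f)) (g\<^sub>1, p) = (\<Sum>d\<in>B. comult H (bvec d) ((g\<^sub>1, p), (g\<^sub>2, f)) *\<^sub>C \<rho> v d)"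
    using assms unfolding right_comodule_def hbasis_H by blast
  then have "\<rho> (\<rho> v (g\<^sub>2, f)) (g\<^sub>1, p) i = (\<Sum>d\<in>B. \<rho> v d i * comult H (bvec d) ((g\<^sub>1, p), (g\<^sub>2, f)))"
    by (simp add: sum_apply mult.commute)
  then show "\<rho> (\<rho> v (g\<^sub>2, f)) (g\<^sub>1, p) i =
      (if p = g\<^sub>2 \<triangleright> f then \<tau> g\<^sub>1 g\<^sub>2 f *\<^sub>C \<rho> v (g\<^sub>1 \<otimes>\<^bsub>G\<^esub> g\<^sub>2, f) else 0) i"
    using assms(3,4) by (simp only: sum_comult_bvec) auto
qed

text \<open>
  The inner product is \<open>\<Sum> ip0 u\<^sub>0 v\<^sub>0 h(v\<^sub>1\<^sup>* u\<^sub>1)\<close> for any inner product \<open>ip0\<close>; since the Haar form is diagonal,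
  only a single sum over the basis remains.
\<close>

lemma invariant_inner_product:
  fixes V :: "'i vec set"
  assumes conds: "star_conditions F G (\<triangleleft>) (\<triangleright>) \<sigma> \<tau> \<alpha>"
    and pos: "\<And>g f. \<lbrakk>g \<in> carrier G; f \<in> carrier F\<rbrakk> \<Longrightarrow> weight \<alpha> g f > 0"
    and V: "right_comodule H V \<rho>"
  shows "\<exists>ip. inner_product_on V ip \<and>
    (\<forall>u\<in>V. \<forall>v\<in>V. (\<Sum>b\<in>B. ip (\<rho> u b) v *\<^sub>C antipode H (bvec b)) =
      (\<Sum>b\<in>B. ip u (\<rho> v b) *\<^sub>C star \<alpha> (bvec b)))"
proof -
  obtain ip0 where ip0: "inner_product_on (UNIV :: 'i vec set) ip0"
    using inner_product_exists by blast
  have ip0_scale: "ip0 (c *\<^sub>C u) v = c * ip0 u v" for c u v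
    using ip0 unfolding inner_product_on_def linear_on_def by blast
  have ip0_herm: "ip0 u v = cnj (ip0 v u)" for u v
    using ip0 unfolding inner_product_on_def by blast
  have ip0_scale': "ip0 u (c *\<^sub>C v) = cnj c * ip0 u v" for c u v
    by (subst (1 2) ip0_herm) (simp add: ip0_scale)
  have ip0_zero: "ip0 0 v = 0" for v
    using inner_product_zero[OF ip0] .
  have ip0_zero': "ip0 v 0 = 0" for v
    by (subst ip0_herm) (simp add: ip0_zero)
  define ip where "ip u v = (\<Sum>b\<in>B. weight \<alpha> (fst b) (snd b) * ip0 (\<rho> u b) (\<rho> v b))" for u v
  have "inner_product_on V ip"
    unfolding ip_def
  proof (rule inner_product_weighted_sum[OF ip0 finite_B])
    show "linear_on V cscale (\<lambda>v. \<rho> v b)" if "b \<in> B" for b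
      using V that unfolding right_comodule_def hbasis_H by blast
    show "v = 0" if "v \<in> V" "\<And>b. b \<in> B \<Longrightarrow> \<rho> v b = 0" for v
    proof -
      have "(\<Sum>d\<in>B. counit H (bvec d) *\<^sub>C \<rho> v d) = v"
        using V that(1) unfolding right_comodule_def hbasis_H by blast
      moreover have "(\<Sum>d\<in>B. counit H (bvec d) *\<^sub>C \<rho> v d) = 0"
        by (intro sum.neutral ballI) (simp only: that(2) cfun.scale_zero_right)
      ultimately show ?thesis by simp
    qed
    show "weight \<alpha> (fst b) (snd b) > 0" if "b \<in> B" for b
      using pos that by auto
  qed
  moreover have "ip (\<rho> u (inv\<^bsub>G\<^esub> k, k \<triangleright> q)) v =
      weight \<alpha> k q * \<tau> (inv\<^bsub>G\<^esub> k) k q * ip u (\<rho> v (k, q))"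
    if uv: "u \<in> V" "v \<in> V" and [simp]: "k \<in> carrier G" "q \<in> carrier F" for u v k q
  proof -
    let ?L = "\<lambda>c. weight \<alpha> c q * \<tau> c (inv\<^bsub>G\<^esub> k) (k \<triangleright> q) *
      ip0 (\<rho> u (c \<otimes>\<^bsub>G\<^esub> inv\<^bsub>G\<^esub> k, k \<triangleright> q)) (\<rho> v (c, q))"
    let ?R = "\<lambda>c. weight \<alpha> c (k \<triangleright> q) * cnj (\<tau> c k q) *
      ip0 (\<rho> u (c, k \<triangleright> q)) (\<rho> v (c \<otimes>\<^bsub>G\<^esub> k, q))"
    have "ip (\<rho> u (inv\<^bsub>G\<^esub> k, k \<triangleright> q)) v = (\<Sum>c\<in>carrier G. \<Sum>p\<in>carrier F. if p = q then ?L c else 0)"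
      unfolding ip_def sum.cartesian_product' using uv
      by (intro sum.cong refl) (auto simp: comodule_coassoc[OF V] ip0_scale ip0_zero)
    also have "\<dots> = (\<Sum>c\<in>carrier G. ?L c)"
      by (simp add: finite_F)
    also have "\<dots> = (\<Sum>c\<in>carrier G. ?L (c \<otimes>\<^bsub>G\<^esub> k))"
      by (rule sum.reindex_bij_witness[where i="\<lambda>c. c \<otimes>\<^bsub>G\<^esub> k" and j="\<lambda>c. c \<otimes>\<^bsub>G\<^esub> inv\<^bsub>G\<^esub> k"])
        (auto simp: G.m_assoc)
    also have "\<dots> = (\<Sum>c\<in>carrier G. weight \<alpha> k q * \<tau> (inv\<^bsub>G\<^esub> k) k q * ?R c)"
    proof (rule sum.cong[OF refl])
      fix c assume [simp]: "c \<in> carrier G"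
      \<comment> \<open>The cocycle condition at \<open>(c, k, k\<inverse>)\<close> absorbs the factor \<open>\<tau> c k q\<close> of \<open>weight_mult\<close> and leaves its conjugate.\<close>
      have "\<tau> (c \<otimes>\<^bsub>G\<^esub> k) (inv\<^bsub>G\<^esub> k) (k \<triangleright> q) * \<tau> c k q = \<tau> (inv\<^bsub>G\<^esub> k) k q"
        using tau_cocycle[of c k "inv\<^bsub>G\<^esub> k" "k \<triangleright> q"] by (simp add: tau_inv)
      then have "weight \<alpha> (c \<otimes>\<^bsub>G\<^esub> k) q * \<tau> (c \<otimes>\<^bsub>G\<^esub> k) (inv\<^bsub>G\<^esub> k) (k \<triangleright> q) =
        weight \<alpha> k q * \<tau> (inv\<^bsub>G\<^esub> k) k q * (weight \<alpha> c (k \<triangleright> q) * cnj (\<tau> c k q))"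
        by (simp add: weight_mult[OF conds] mult_ac flip: \<open>_ = \<tau> (inv\<^bsub>G\<^esub> k) k q\<close>)
      then show "?L (c \<otimes>\<^bsub>G\<^esub> k) = weight \<alpha> k q * \<tau> (inv\<^bsub>G\<^esub> k) k q * ?R c"
        by (simp add: G.m_assoc)
    qed
    also have "\<dots> = weight \<alpha> k q * \<tau> (inv\<^bsub>G\<^esub> k) k q * (\<Sum>c\<in>carrier G. ?R c)"
      by (simp add: sum_distrib_left)
    also have "(\<Sum>c\<in>carrier G. ?R c) = (\<Sum>c\<in>carrier G. \<Sum>p\<in>carrier F. if p = k \<triangleright> q then ?R c else 0)"
      by (simp add: finite_F)
    also have "\<dots> = ip u (\<rho> v (k, q))"
      unfolding ip_def sum.cartesian_product' using uv
      by (intro sum.cong refl) (auto simp: comodule_coassoc[OF V] ip0_scale' ip0_zero')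
    finally show ?thesis .
  qed
  ultimately show ?thesis
    by (intro exI[of _ ip]) (simp add: invariance_iff)
qed

text \<open>
  The coproduct makes the Hopf algebra a comodule over itself.  Here it is transported along an injection
  \<open>j\<close> into the index type over which comodules range: \<open>E\<close> embeds the coordinate space, and \<open>R\<close> restricts
  back to it.
\<close>

lemma regular_comodule:
  fixes j :: "'g \<times> 'f \<Rightarrow> 'i"
  assumes j: "inj_on j B"
  defines "E \<equiv> lin_ext B (\<lambda>b. bvec (j b))"
    and "R \<equiv> \<lambda>v b. if b \<in> B then v (j b) else 0"
  shows "right_comodule H (vecs (j ` B)) (\<lambda>v b. E (\<lambda>a. comult H (R v) (a, b)))"
proof -
  have E_j: "E x (j b) = x b" if "b \<in> B" for x b
  proof -
    have "E x (j b) = (\<Sum>c\<in>B. x c * bvec c b)"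
      unfolding E_def lin_ext_apply using j that
      by (intro sum.cong refl) (auto simp: bvec_apply inj_on_eq_iff)
    then show ?thesis using sum_bvec[OF finite_B that] by simp
  qed
  have E_out: "E x i = 0" if "i \<notin> j ` B" for x i
    unfolding E_def lin_ext_apply using that by (auto simp: bvec_apply intro!: sum.neutral)
  have eqI: "u = v" if "u \<in> vecs (j ` B)" "v \<in> vecs (j ` B)" "\<And>b. b \<in> B \<Longrightarrow> u (j b) = v (j b)" for u v
  proof
    fix i show "u i = v i" using that by (cases "i \<in> j ` B") (auto simp: vecs_zero_outside)
  qed
  have E_closed: "E x \<in> vecs (j ` B)" for x
    using E_out by (auto simp: vecs_def)
  have RE: "R (E x) b = x b" if "b \<in> B" for x b
    using E_j that by (simp add: R_def)
  have sub: "cfun.subspace (vecs (j ` B))"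
    by (auto simp: cfun.subspace_def vecs_def)
  have R_add: "R (u + v) = R u + R v" and R_scale: "R (c *\<^sub>C u) = c *\<^sub>C R u" for u v c
    by (auto simp: R_def)
  have lin: "linear_on (vecs (j ` B)) cscale (\<lambda>v. E (\<lambda>a. comult H (R v) (a, b)))" for b
    unfolding linear_on_def R_add R_scale comult_add comult_scale
    by (auto intro!: ext simp: E_def lin_ext_apply algebra_simps sum.distrib sum_distrib_left)
  have coassoc: "E (\<lambda>a. comult H (R (E (\<lambda>a. comult H (R v) (a, c)))) (a, b)) =
    (\<Sum>d\<in>B. comult H (bvec d) (b, c) *\<^sub>C E (\<lambda>a. comult H (R v) (a, d)))"
    if "b \<in> B" "c \<in> B" for v b c
  proof (rule eqI[OF E_closed])
    show "(\<Sum>d\<in>B. comult H (bvec d) (b, c) *\<^sub>C E (\<lambda>a. comult H (R v) (a, d))) \<in> vecs (j ` B)"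
      by (intro cfun.subspace_sum[OF sub] cfun.subspace_scale[OF sub] E_closed)
    fix a assume a: "a \<in> B"
    obtain a1 a2 b1 b2 c1 c2 where abc: "a = (a1, a2)" "b = (b1, b2)" "c = (c1, c2)"
      by (cases a; cases b; cases c)
    then have [simp]: "a1 \<in> carrier G" "a2 \<in> carrier F" "b1 \<in> carrier G" "b2 \<in> carrier F"
      "c1 \<in> carrier G" "c2 \<in> carrier F" using a that by auto
    have "E (\<lambda>a. comult H (R (E (\<lambda>a. comult H (R v) (a, c)))) (a, b)) (j a) =
      lin_ext (B \<times> B) (\<lambda>(u, v). comult H (bvec u) \<boxtimes> bvec v) (comult H (R v)) ((a, b), c)"
      using a that(2) unfolding E_j[OF a] unfolding abc
      by (simp only: comult_bvec_sum_left) (simp add: comult_apply RE)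
    also have "\<dots> = lin_ext (B \<times> B) (\<lambda>(u, v). bvec u \<boxtimes> comult H (bvec v)) (comult H (R v)) (a, (b, c))"
      by (rule comult_coassoc)
    also have "\<dots> = (\<Sum>d\<in>B. comult H (R v) (a, d) * comult H (bvec d) (b, c))"
      using a unfolding abc by (simp only: comult_bvec_sum_right sum_comult_bvec)
    finally show "E (\<lambda>a. comult H (R (E (\<lambda>a. comult H (R v) (a, c)))) (a, b)) (j a) =
      (\<Sum>d\<in>B. comult H (bvec d) (b, c) *\<^sub>C E (\<lambda>a. comult H (R v) (a, d))) (j a)"
      by (simp add: sum_apply E_j[OF a] mult.commute)
  qed
  have counit: "(\<Sum>d\<in>B. counit H (bvec d) *\<^sub>C E (\<lambda>a. comult H (R v) (a, d))) = v"
    if "v \<in> vecs (j ` B)" for v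
  proof (rule eqI[OF _ that])
    show "(\<Sum>d\<in>B. counit H (bvec d) *\<^sub>C E (\<lambda>a. comult H (R v) (a, d))) \<in> vecs (j ` B)"
      by (intro cfun.subspace_sum[OF sub] cfun.subspace_scale[OF sub] E_closed)
    fix a assume a: "a \<in> B"
    then show "(\<Sum>d\<in>B. counit H (bvec d) *\<^sub>C E (\<lambda>a. comult H (R v) (a, d))) (j a) = v (j a)"
      using sum_comult_counit[OF a, of "R v"] by (simp add: sum_apply E_j[OF a] mult.commute R_def)
  qed
  show ?thesis
    unfolding right_comodule_def hbasis_H using sub E_closed lin coassoc counit by blast
qed

text \<open>
  Invariance is applied at \<open>(k, q)\<close> to \<open>u = e\<^sub>1 # (k \<triangleright> q)\<close> and \<open>v = e\<^sub>k # q\<close> in the regular comodule.  The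
  component of the coaction at \<open>(k, q)\<close> sends \<open>v\<close> to \<open>u\<close>, and the component at \<open>(k\<inverse>, k \<triangleright> q)\<close> sends \<open>u\<close>
  to a multiple of \<open>v\<close>, so the resulting equation is \<open>ip v v = w(k, q) ip u u\<close>.
\<close>

lemma weight_pos:
  assumes cqg: "compact_quantum_group TYPE('i::infinite) H (star \<alpha>)"
    and [simp]: "k \<in> carrier G" "q \<in> carrier F"
  shows "weight \<alpha> k q > 0"
proof -
  obtain j :: "'g \<times> 'f \<Rightarrow> 'i" where j: "inj_on j B"
    using finite_B infinite_arbitrarily_large[OF infinite_UNIV, of "card B"]
    by (metis bij_betw_iff_card bij_betw_imp_inj_on)
  define E where "E = lin_ext B (\<lambda>b. bvec (j b) :: 'i vec)"
  define R where "R = (\<lambda>v b. if b \<in> B then v (j b) else 0 :: complex)"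
  define \<rho> where "\<rho> v b = E (\<lambda>a. comult H (R v) (a, b))" for v b
  have comod: "right_comodule H (vecs (j ` B)) \<rho>"
    unfolding \<rho>_def[abs_def] E_def R_def by (rule regular_comodule[OF j])
  then obtain ip where ip: "inner_product_on (vecs (j ` B)) ip"
    and inv: "\<And>u v. \<lbrakk>u \<in> vecs (j ` B); v \<in> vecs (j ` B)\<rbrakk> \<Longrightarrow>
      (\<Sum>b\<in>B. ip (\<rho> u b) v *\<^sub>C antipode H (bvec b)) = (\<Sum>b\<in>B. ip u (\<rho> v b) *\<^sub>C star \<alpha> (bvec b))"
    using cqg unfolding compact_quantum_group_def hbasis_H by blast
  have E_bvec: "E (bvec b) = bvec (j b)" if "b \<in> B" for b
    unfolding E_def lin_ext_def
  proof -
    have "(\<Sum>c\<in>B. bvec b c *\<^sub>C bvec (j c)) i = (\<Sum>c\<in>B. bvec (j c) i * bvec c b)" for i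
      unfolding sum_apply by (rule sum.cong) (auto simp: bvec_apply)
    then show "(\<Sum>c\<in>B. bvec b c *\<^sub>C bvec (j c)) = bvec (j b)"
      using sum_bvec[OF finite_B that] by auto
  qed
  have E_scale: "E (c *\<^sub>C x) = c *\<^sub>C E x" for c x
    by (simp add: E_def lin_ext_scale)
  have R_bvec: "R (bvec (j b)) = bvec b" if "b \<in> B" for b
    using that j by (auto simp: R_def bvec_apply inj_on_eq_iff)
  let ?u = "bvec (j (\<one>\<^bsub>G\<^esub>, k \<triangleright> q)) :: 'i vec" and ?v = "bvec (j (k, q)) :: 'i vec"
  have u: "?u \<in> vecs (j ` B)" "?u \<noteq> 0" and v: "?v \<in> vecs (j ` B)" "?v \<noteq> 0"
    by (auto simp: bvec_in_vecs) (metis bvec_apply zero_fun_def zero_neq_one)+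
  have rho_v: "\<rho> ?v (k, q) = ?u"
  proof -
    have "(\<lambda>a. comult H (bvec (k, q)) (a, (k, q))) = bvec (\<one>\<^bsub>G\<^esub>, k \<triangleright> q)"
      by (rule ext) (auto simp: comult_apply bvec_apply split: prod.splits if_splits)
    then show ?thesis by (simp add: \<rho>_def R_bvec E_bvec)
  qed
  have rho_u: "\<rho> ?u (inv\<^bsub>G\<^esub> k, k \<triangleright> q) = \<tau> (inv\<^bsub>G\<^esub> k) k q *\<^sub>C ?v"
  proof -
    have iff: "a \<otimes>\<^bsub>G\<^esub> inv\<^bsub>G\<^esub> k = \<one>\<^bsub>G\<^esub> \<longleftrightarrow> a = k" if "a \<in> carrier G" for a
      using that by (metis G.inv_closed G.inv_equality G.inv_inv G.r_inv assms(2))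
    have "(\<lambda>a. comult H (bvec (\<one>\<^bsub>G\<^esub>, k \<triangleright> q)) (a, (inv\<^bsub>G\<^esub> k, k \<triangleright> q))) = \<tau> (inv\<^bsub>G\<^esub> k) k q *\<^sub>C bvec (k, q)"
      by (rule ext) (auto simp: comult_apply bvec_apply iff tau_inv split: prod.splits if_splits)
    then show ?thesis by (simp add: \<rho>_def R_bvec E_bvec E_scale)
  qed
  have "ip (\<rho> ?u (inv\<^bsub>G\<^esub> k, k \<triangleright> q)) ?v = weight \<alpha> k q * \<tau> (inv\<^bsub>G\<^esub> k) k q * ip ?u (\<rho> ?v (k, q))"
    using inv[OF u(1) v(1)] unfolding invariance_iff by simp
  moreover have "ip (c *\<^sub>C ?v) ?v = c * ip ?v ?v" for c
    using ip v(1) unfolding inner_product_on_def linear_on_def by blast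
  ultimately have "\<tau> (inv\<^bsub>G\<^esub> k) k q * ip ?v ?v = \<tau> (inv\<^bsub>G\<^esub> k) k q * (weight \<alpha> k q * ip ?u ?u)"
    by (simp add: rho_u rho_v)
  then have eq: "ip ?v ?v = weight \<alpha> k q * ip ?u ?u"
    using tau_nonzero[of "inv\<^bsub>G\<^esub> k" k q] by simp
  moreover have "ip ?u ?u > 0" "ip ?v ?v > 0"
    using ip u v unfolding inner_product_on_def by blast+
  ultimately show ?thesis
    by (auto simp: less_complex_def zero_less_mult_iff)
qed

theorem compact_quantum_group_iff:
  "compact_quantum_group TYPE('i::infinite) H (star \<alpha>) \<longleftrightarrow>
    star_conditions F G (\<triangleleft>) (\<triangleright>) \<sigma> \<tau> \<alpha> \<and> (\<forall>g\<in>carrier G. \<forall>f\<in>carrier F. weight \<alpha> g f > 0)"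
proof
  assume cqg: "compact_quantum_group TYPE('i::infinite) H (star \<alpha>)"
  then have "star_conditions F G (\<triangleleft>) (\<triangleright>) \<sigma> \<tau> \<alpha>"
    by (simp add: compact_quantum_group_def star_hopf_algebra_iff)
  then show "star_conditions F G (\<triangleleft>) (\<triangleright>) \<sigma> \<tau> \<alpha> \<and> (\<forall>g\<in>carrier G. \<forall>f\<in>carrier F. weight \<alpha> g f > 0)"
    using weight_pos[OF cqg] by blast
next
  assume "star_conditions F G (\<triangleleft>) (\<triangleright>) \<sigma> \<tau> \<alpha> \<and> (\<forall>g\<in>carrier G. \<forall>f\<in>carrier F. weight \<alpha> g f > 0)"
  then show "compact_quantum_group TYPE('i::infinite) H (star \<alpha>)"
    using invariant_inner_product unfolding compact_quantum_group_def hbasis_H star_hopf_algebra_iff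
    by blast
qed

end

section \<open>Characterisation of the involutions and of compactness\<close>

theorem theorem6p14:
  fixes F :: "('f, 'm) monoid_scheme" and G :: "('g, 'n) monoid_scheme"
    and la :: "'g \<Rightarrow> 'f \<Rightarrow> 'g" (infixl "\<triangleleft>" 75)
    and ra :: "'g \<Rightarrow> 'f \<Rightarrow> 'f" (infixr "\<triangleright>" 75)
    and \<sigma> :: "'g \<Rightarrow> 'f \<Rightarrow> 'f \<Rightarrow> complex"
    and \<tau> :: "'g \<Rightarrow> 'g \<Rightarrow> 'f \<Rightarrow> complex"
    and \<alpha> :: "'f \<Rightarrow> 'g \<Rightarrow> complex"
  assumes "finite (carrier F)" and "finite (carrier G)"
    and "matched_pair F G (\<triangleleft>) (\<triangleright>)"
    and "compatible_normal_cocycles F G (\<triangleleft>) (\<triangleright>) \<sigma> \<tau>"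
  shows
    "(star_hopf_algebra (bicrossed F G (\<triangleleft>) (\<triangleright>) \<sigma> \<tau>) (bicrossed_star F G (\<triangleleft>) \<alpha>) \<longleftrightarrow>
        star_conditions F G (\<triangleleft>) (\<triangleright>) \<sigma> \<tau> \<alpha>) \<and>
     (compact_quantum_group TYPE('i::infinite)
          (bicrossed F G (\<triangleleft>) (\<triangleright>) \<sigma> \<tau>) (bicrossed_star F G (\<triangleleft>) \<alpha>) \<longleftrightarrow>
        star_conditions F G (\<triangleleft>) (\<triangleright>) \<sigma> \<tau> \<alpha> \<and>
        (\<forall>g\<in>carrier G. \<forall>f\<in>carrier F. \<alpha> (inv\<^bsub>F\<^esub> f) (g \<triangleleft> f) * \<sigma> g f (inv\<^bsub>F\<^esub> f) > 0))"
proof -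
  interpret finite_bicrossed F G la ra \<sigma> \<tau>
    using assms by (intro finite_bicrossed.intro finite_bicrossed_axioms.intro)
  show ?thesis
    using star_hopf_algebra_iff compact_quantum_group_iff by (simp add: weight_def)
qed

end
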